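(* Let $p>2$. Assume that $G$ is a graph with three edges which meet at the origin, one of them being a half-line and the two others having lengths $\ell_1,\ell_2\in(0,+\infty)$. If $\ell_1$ is small enough and $\ell_2$ is large enough (i.e. there exist $\delta>0$ and $L>0$, depending on $p$, such that the following holds whenever $0<\ell_1<\delta$ and $\ell_2>L$), there are at least two different non-negative, not identically zero solutions to the Kirkhoff-ODE system in $G$.
   Context: The origin is the only inner vertex of $G$; the outer endpoints of the two bounded edges are the outer vertices. $H^1_0(G)$ is the set of continuous functions $v$ on $G$ belonging to $H^1(e)$ for each edge $e$ and vanishing at the two outer vertices. A solution to the Kirkhoff-ODE system in $G$ is a function $v\in H^1_0(G)$ satisfying $-v''+v=|v|^{p-2}v$ in each edge (with respect to arc length) and the Kirkhoff condition at the origin: the sum of the three outward derivatives of $v$ at the origin, taken in the direction of each of the three edges, equals $0$. *)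

theory Defs
  imports "HOL-Analysis.Analysis"
begin

section \<open>One-dimensional Sobolev spaces\<close>

text \<open>Smooth functions with compact support contained in the open set \<open>I\<close>.\<close>

definition test_function :: "real set \<Rightarrow> (real \<Rightarrow> real) \<Rightarrow> bool" where
  "test_function I \<phi> \<longleftrightarrow>
     (\<forall>k. (deriv ^^ k) \<phi> differentiable_on UNIV) \<and>
     compact (closure {x. \<phi> x \<noteq> 0}) \<and> closure {x. \<phi> x \<noteq> 0} \<subseteq> I"

definition L2_on :: "real set \<Rightarrow> (real \<Rightarrow> real) \<Rightarrow> bool" where
  "L2_on I f \<longleftrightarrow>
     set_borel_measurable lebesgue I f \<and> set_integrable lebesgue I (\<lambda>x. (f x)\<^sup>2)"

text \<open>In the next two definitions \<open>I\<close> is meant to be open.\<close>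

definition weak_derivative_on :: "real set \<Rightarrow> (real \<Rightarrow> real) \<Rightarrow> (real \<Rightarrow> real) \<Rightarrow> bool" where
  "weak_derivative_on I f g \<longleftrightarrow>
     (\<forall>\<phi>. test_function I \<phi> \<longrightarrow>
        (LINT x:I|lebesgue. f x * deriv \<phi> x) = - (LINT x:I|lebesgue. g x * \<phi> x))"

definition H1_on :: "real set \<Rightarrow> (real \<Rightarrow> real) \<Rightarrow> bool" where
  "H1_on I f \<longleftrightarrow> L2_on I f \<and> (\<exists>g. L2_on I g \<and> weak_derivative_on I f g)"


section \<open>The metric graph\<close>

text \<open>
  Every edge is parametrised by arc length, starting from the origin, so that the parameter \<open>0\<close>
  on all three edges denotes one and the same point of the graph. A function on the graph is
  given by its restrictions \<open>v e\<close> to the edges; these must agree at \<open>0\<close>, and only their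
  values on the parameter intervals \<open>edge_dom l1 l2 e\<close> are relevant.
\<close>

datatype edge = Half_Line | Edge1 | Edge2

fun edge_dom :: "real \<Rightarrow> real \<Rightarrow> edge \<Rightarrow> real set" where
  "edge_dom l1 l2 Half_Line = {0..}"
| "edge_dom l1 l2 Edge1 = {0..l1}"
| "edge_dom l1 l2 Edge2 = {0..l2}"

definition continuous_on_graph :: "real \<Rightarrow> real \<Rightarrow> (edge \<Rightarrow> real \<Rightarrow> real) \<Rightarrow> bool" where
  "continuous_on_graph l1 l2 v \<longleftrightarrow>
     (\<forall>e e'. v e 0 = v e' 0) \<and> (\<forall>e. continuous_on (edge_dom l1 l2 e) (v e))"

definition H10_graph :: "real \<Rightarrow> real \<Rightarrow> (edge \<Rightarrow> real \<Rightarrow> real) set" where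
  "H10_graph l1 l2 =
     {v. continuous_on_graph l1 l2 v \<and>
         (\<forall>e. H1_on (interior (edge_dom l1 l2 e)) (v e)) \<and>
         v Edge1 l1 = 0 \<and> v Edge2 l2 = 0}"


section \<open>The Kirchhoff-ODE system\<close>

definition ode_on :: "real \<Rightarrow> real set \<Rightarrow> (real \<Rightarrow> real) \<Rightarrow> bool" where
  "ode_on p I f \<longleftrightarrow>
     (\<exists>f' f''. \<forall>x\<in>I. (f has_real_derivative f' x) (at x) \<and>
                     (f' has_real_derivative f'' x) (at x) \<and>
                     - f'' x + f x = \<bar>f x\<bar> powr (p - 2) * f x)"

definition kirchhoff :: "real \<Rightarrow> real \<Rightarrow> (edge \<Rightarrow> real \<Rightarrow> real) \<Rightarrow> bool" where
  "kirchhoff l1 l2 v \<longleftrightarrow>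
     (\<exists>d. (\<forall>e. (v e has_real_derivative d e) (at 0 within edge_dom l1 l2 e)) \<and>
          d Half_Line + d Edge1 + d Edge2 = 0)"

definition kirchhoff_solution :: "real \<Rightarrow> real \<Rightarrow> real \<Rightarrow> (edge \<Rightarrow> real \<Rightarrow> real) \<Rightarrow> bool" where
  "kirchhoff_solution p l1 l2 v \<longleftrightarrow>
     v \<in> H10_graph l1 l2 \<and>
     (\<forall>e. ode_on p (interior (edge_dom l1 l2 e)) (v e)) \<and>
     kirchhoff l1 l2 v"

definition nonneg_on_graph :: "real \<Rightarrow> real \<Rightarrow> (edge \<Rightarrow> real \<Rightarrow> real) \<Rightarrow> bool" where
  "nonneg_on_graph l1 l2 v \<longleftrightarrow> (\<forall>e. \<forall>x\<in>edge_dom l1 l2 e. 0 \<le> v e x)"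

definition eq_on_graph ::
  "real \<Rightarrow> real \<Rightarrow> (edge \<Rightarrow> real \<Rightarrow> real) \<Rightarrow> (edge \<Rightarrow> real \<Rightarrow> real) \<Rightarrow> bool" where
  "eq_on_graph l1 l2 u v \<longleftrightarrow> (\<forall>e. \<forall>x\<in>edge_dom l1 l2 e. u e x = v e x)"

end

theory Submission
  imports Defs
begin

text \<open>
  On the half-line a positive solution is a shifted soliton, so a value \<open>a\<close> at the origin leaves
  two choices: the half-line carries a decaying tail or a tail preceded by a full bump, with
  derivatives \<open>- r\<close> and \<open>r\<close> at the origin, where \<open>r\<^sup>2 = a\<^sup>2 - 2 a\<^sup>p / p\<close>. On the short edge the
  solution drops from \<open>a \<le> 1\<close> to \<open>0\<close>; it is convex there, so its slope \<open>- D\<close> at the origin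
  satisfies \<open>D \<ge> a / l1\<close>. For \<open>l1 < 1 / 4\<close> this dominates \<open>r\<close>, and the Kirchhoff condition
  prescribes a positive slope \<open>D \<plusminus> r\<close> and a positive energy on the long edge: there the solution
  rises to a maximum and then falls to \<open>0\<close>. The length travelled depends continuously on \<open>a\<close>, is
  bounded independently of \<open>l1\<close> at \<open>a = 1\<close>, and tends to infinity as \<open>a\<close> tends to \<open>0\<close>, because
  the energy then vanishes. Hence it equals \<open>l2\<close> for some \<open>a\<close>, for each of the two choices.
\<close>

subsection \<open>Preliminaries from analysis\<close>

text \<open>The derivative is written in the form of the nonlinearity, so that one formula covers
  both signs of \<open>x\<close> and 0. At 0 the difference quotient is bounded by
  \<open>\<bar>h\<bar> powr (r - 1)\<close>, which tends to 0 because \<open>r > 1\<close>.\<close>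

lemma has_real_derivative_abs_powr:
  fixes x r :: real
  assumes "r > 1"
  shows "((\<lambda>x. \<bar>x\<bar> powr r) has_real_derivative r * (\<bar>x\<bar> powr (r - 2) * x)) (at x)"
proof -
  consider "x > 0" | "x < 0" | "x = 0" by linarith
  then show ?thesis
  proof cases
    case 1
    have "((\<lambda>x. x powr r) has_real_derivative r * x powr (r - 1)) (at x)"
      using 1 by (rule has_real_derivative_powr)
    moreover have "x powr (r - 1) = \<bar>x\<bar> powr (r - 2) * x"
      using 1 powr_mult_base[of x "r - 2"] by (simp add: mult.commute)
    moreover have "\<forall>\<^sub>F y in nhds x. \<bar>y\<bar> powr r = y powr r"
      using 1 eventually_nhds_in_open[of "{0<..}" x] by (auto elim: eventually_mono)
    ultimately show ?thesis by (subst DERIV_cong_ev[OF refl _ refl]) auto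
  next
    case 2
    have "((\<lambda>x. (-x) powr r) has_real_derivative (r * (-x) powr (r - 1)) * (-1)) (at x)"
      using 2 by (intro DERIV_chain2[where f="\<lambda>x. x powr r"] has_real_derivative_powr) (auto intro!: derivative_eq_intros)
    moreover have "(-x) powr (r - 1) = \<bar>x\<bar> powr (r - 2) * (-x)"
      using 2 powr_mult_base[of "-x" "r - 2"] by (simp add: mult.commute)
    moreover have "\<forall>\<^sub>F y in nhds x. \<bar>y\<bar> powr r = (-y) powr r"
      using 2 eventually_nhds_in_open[of "{..<0}" x] by (auto elim: eventually_mono)
    ultimately show ?thesis by (subst DERIV_cong_ev[OF refl _ refl]) auto
  next
    case 3
    have "((\<lambda>h::real. \<bar>h\<bar> powr (r - 1)) \<longlongrightarrow> 0) (at 0)"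
      using assms by (intro tendsto_zero_powrI tendsto_rabs_zero tendsto_ident_at) (auto intro!: always_eventually tendsto_eq_intros)
    then have "((\<lambda>h::real. \<bar>h\<bar> powr r / h) \<longlongrightarrow> 0) (at 0)"
    proof (rule Lim_null_comparison[rotated])
      show "\<forall>\<^sub>F h in at (0::real). norm (\<bar>h\<bar> powr r / h) \<le> \<bar>h\<bar> powr (r - 1)"
        by (intro always_eventually allI) (auto simp: powr_diff)
    qed
    then show ?thesis using 3 assms by (simp add: DERIV_def)
  qed
qed

text \<open>Monotonicity replaces the implicit function theorem. For fixed \<open>u < y x\<close>
  the inequality \<open>F x' u > z x'\<close> persists for \<open>x'\<close> near \<open>x\<close>
  by continuity in the first argument alone, and strict decrease in the second argument turns it
  into \<open>u < y x'\<close>. Upper bounds are symmetric.\<close>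

lemma continuous_on_implicit_antimono:
  fixes y :: "real \<Rightarrow> real" and F :: "real \<Rightarrow> real \<Rightarrow> real"
  assumes y: "\<And>x. x \<in> S \<Longrightarrow> b < y x \<and> F x (y x) = z x"
    and anti: "\<And>x s t. x \<in> S \<Longrightarrow> b < s \<Longrightarrow> s < t \<Longrightarrow> F x t < F x s"
    and cont: "\<And>t. b < t \<Longrightarrow> continuous_on S (\<lambda>x. F x t)" "continuous_on S z"
  shows "continuous_on S y"
  unfolding continuous_on_def
proof (intro ballI order_tendstoI)
  fix x t assume x: "x \<in> S" and t: "t < y x"
  define u where "u = (max b t + y x) / 2"
  have u: "b < u" "t < u" "u < y x" using y[OF x] t unfolding u_def by auto
  have "F x u - z x > 0" using anti[OF x u(1,3)] y[OF x] by simp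
  moreover have "((\<lambda>x. F x u - z x) \<longlongrightarrow> F x u - z x) (at x within S)"
    using continuous_on_diff[OF cont(1)[OF u(1)] cont(2)] x unfolding continuous_on_def by blast
  ultimately have "\<forall>\<^sub>F x in at x within S. F x u - z x > 0" by (rule order_tendstoD(1)[rotated])
  moreover have "\<forall>\<^sub>F x in at x within S. x \<in> S" by (simp add: eventually_at_filter)
  ultimately show "\<forall>\<^sub>F x in at x within S. t < y x"
  proof eventually_elim
    case (elim x')
    show ?case
    proof (rule ccontr)
      assume "\<not> t < y x'"
      then have "F x' u < F x' (y x')" using y[OF elim(2)] u by (intro anti[OF elim(2)]) auto
      then show False using elim(1) y[OF elim(2)] by simp
    qed
  qed
next
  fix x t assume x: "x \<in> S" and t: "y x < t"
  have b: "b < t" using y[OF x] t by simp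
  have "F x t - z x < 0" using anti[OF x _ t] y[OF x] by simp
  moreover have "((\<lambda>x. F x t - z x) \<longlongrightarrow> F x t - z x) (at x within S)"
    using continuous_on_diff[OF cont(1)[OF b] cont(2)] x unfolding continuous_on_def by blast
  ultimately have "\<forall>\<^sub>F x in at x within S. F x t - z x < 0" by (rule order_tendstoD(2)[rotated])
  moreover have "\<forall>\<^sub>F x in at x within S. x \<in> S" by (simp add: eventually_at_filter)
  ultimately show "\<forall>\<^sub>F x in at x within S. y x < t"
  proof eventually_elim
    case (elim x')
    show ?case
    proof (rule ccontr)
      assume "\<not> y x' < t"
      then have "t = y x' \<or> F x' (y x') < F x' t"
        using anti[OF elim(2) b, of "y x'"] by linarith
      then show False using elim(1) y[OF elim(2)] anti[OF elim(2) b, of "y x'"] \<open>\<not> y x' < t\<close> by auto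
    qed
  qed
qed

text \<open>The scaled integral is the antiderivative of \<open>f\<close> that vanishes at 0.
  Integrating over the fixed interval from 0 to 1 covers both signs of \<open>x\<close> at once and
  later allows continuity in a parameter.\<close>

lemma has_real_derivative_scaled_integral:
  fixes f :: "real \<Rightarrow> real"
  assumes "continuous_on UNIV f"
  shows "((\<lambda>x. x * integral {0..1} (\<lambda>t. f (x * t))) has_real_derivative f x) (at x)"
proof -
  obtain F where F: "\<And>x. (F has_real_derivative f x) (at x)"
    using einterval_antiderivative[of "-\<infinity>" "\<infinity>" f] assms
    by (auto simp: has_real_derivative_iff_has_vector_derivative continuous_on_eq_continuous_at)
  have "x * integral {0..1} (\<lambda>t. f (x * t)) = F x - F 0" for x
  proof -
    have d: "((\<lambda>t. F (x * t)) has_real_derivative x * f (x * t)) (at t)" for t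
      using DERIV_chain2[OF F, of "\<lambda>t. x * t" x t UNIV] DERIV_cmult_Id[of x t UNIV]
      by (simp add: mult.commute[of _ x])
    then have d': "((\<lambda>t. F (x * t)) has_vector_derivative x * f (x * t)) (at t within {0..1})" for t
      unfolding has_real_derivative_iff_has_vector_derivative by (rule has_vector_derivative_at_within)
    have "((\<lambda>t. x * f (x * t)) has_integral (F (x * 1) - F (x * 0))) {0..1}"
      by (rule fundamental_theorem_of_calculus[OF _ d']) simp
    then have "integral {0..1} (\<lambda>t. x * f (x * t)) = F x - F 0" by (simp only: integral_unique) simp
    then show ?thesis by (simp only: integral_mult_right)
  qed
  then have "(\<lambda>x. x * integral {0..1} (\<lambda>t. f (x * t))) = (\<lambda>x. F x - F 0)" by (rule ext)
  then show ?thesis using F by (auto intro!: derivative_eq_intros)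
qed

section \<open>Square integrability and weak derivatives\<close>

lemma set_borel_measurable_lebesgue_continuous:
  fixes f :: "real \<Rightarrow> real"
  assumes "continuous_on UNIV f" "I \<in> sets borel"
  shows "set_borel_measurable lebesgue I f"
proof -
  have [measurable]: "f \<in> borel_measurable borel" "I \<in> sets borel"
    using assms by (auto intro: borel_measurable_continuous_onI)
  show ?thesis unfolding set_borel_measurable_def by (intro measurable_completion) simp
qed

lemma L2_on_bounded_interval:
  assumes "continuous_on UNIV f"
  shows "L2_on {a<..<b} f"
proof -
  have "set_integrable lebesgue {a..b} (\<lambda>x. (f x)\<^sup>2)"
    by (intro absolutely_integrable_continuous_real continuous_intros continuous_on_subset[OF assms]) auto
  then have "set_integrable lebesgue {a<..<b} (\<lambda>x. (f x)\<^sup>2)"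
    by (rule set_integrable_subset) auto
  then show ?thesis unfolding L2_on_def
    using set_borel_measurable_lebesgue_continuous[OF assms] by simp
qed

lemma L2_on_exp_decay:
  assumes "continuous_on UNIV f" and bd: "\<And>x. x > 0 \<Longrightarrow> \<bar>f x\<bar> \<le> C * exp (- x)"
  shows "L2_on {0<..} f"
proof -
  have "(\<lambda>x::real. exp (-2 * x)) absolutely_integrable_on {0..}"
    using has_integral_exp_minus_to_infinity[of "2::real" 0]
    by (intro nonnegative_absolutely_integrable_1) (auto simp: integrable_on_def)
  then have e: "set_integrable lebesgue {0..} (\<lambda>x. C\<^sup>2 * exp (-2 * x))" by simp
  have "set_integrable lebesgue {0<..} (\<lambda>x. (f x)\<^sup>2)"
  proof (rule set_integrable_bound[OF set_integrable_subset[OF e]])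
    show "AE x in lebesgue. x \<in> {0<..} \<longrightarrow> norm ((f x)\<^sup>2) \<le> norm (C\<^sup>2 * exp (-2 * x))"
    proof (intro AE_I2 impI)
      fix x :: real assume "x \<in> {0<..}"
      then have "\<bar>f x\<bar>\<^sup>2 \<le> (C * exp (- x))\<^sup>2" using bd[of x] by (intro power_mono) auto
      also have "\<dots> = C\<^sup>2 * exp (-2 * x)" by (simp add: power_mult_distrib flip: exp_double)
      finally show "norm ((f x)\<^sup>2) \<le> norm (C\<^sup>2 * exp (-2 * x))" by (simp add: abs_mult)
    qed
    show "set_borel_measurable lebesgue {0<..} (\<lambda>x. (f x)\<^sup>2)"
      by (intro set_borel_measurable_lebesgue_continuous continuous_intros assms) simp
  qed auto
  then show ?thesis unfolding L2_on_def
    using set_borel_measurable_lebesgue_continuous[OF assms(1)] by simp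
qed

text \<open>Integration by parts on an interval around the support of the test function; the
  boundary terms vanish there.\<close>

lemma weak_derivative_on_C1:
  assumes f: "\<And>x. (f has_real_derivative f' x) (at x)" and f': "continuous_on UNIV f'"
  shows "weak_derivative_on I f f'"
  unfolding weak_derivative_on_def
proof (intro allI impI)
  fix \<phi> assume "test_function I \<phi>"
  define K where "K = closure {x. \<phi> x \<noteq> 0}"
  have diff: "(deriv ^^ k) \<phi> differentiable_on UNIV" and K: "compact K" "K \<subseteq> I" for k
    using \<open>test_function I \<phi>\<close> unfolding test_function_def K_def by auto
  have \<phi>: "(\<phi> has_real_derivative deriv \<phi> x) (at x)" for x
    using diff[of 0] by (simp add: differentiable_on_def DERIV_deriv_iff_real_differentiable)
  have c: "continuous_on UNIV f" "continuous_on UNIV \<phi>" "continuous_on UNIV (deriv \<phi>)"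
    using f \<phi> diff[of 1] by (auto intro: DERIV_continuous_on differentiable_imp_continuous_on)
  have \<phi>0: "\<phi> x = 0" if "x \<notin> K" for x
    using that closure_subset[of "{x. \<phi> x \<noteq> 0}"] unfolding K_def by auto
  have d0: "deriv \<phi> x = 0" if "x \<notin> K" for x
  proof -
    have "(\<phi> has_real_derivative 0) (at x)"
    proof (rule has_field_derivative_transform_within_open[of "\<lambda>_. 0"])
      show "open (- K)" unfolding K_def by blast
    qed (use that \<phi>0 in auto)
    then show ?thesis by (rule DERIV_imp_deriv)
  qed
  obtain B where B: "B > 0" "\<forall>x\<in>K. norm x \<le> B"
    using compact_imp_bounded[OF K(1)] unfolding bounded_pos by blast
  \<comment> \<open>The extra 1 puts the support strictly inside, so that \<open>\<phi>\<close> is 0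
    at both endpoints.\<close>
  define N where "N = B + 1"
  have N: "\<bar>x\<bar> < N" if "x \<in> K" for x using bspec[OF B(2) that] unfolding N_def by simp
  have N0: "N > 0" using B(1) unfolding N_def by simp
  \<comment> \<open>An integrand vanishing off \<open>K\<close> has the same integral over every set
    containing \<open>K\<close>, which makes the shape of \<open>I\<close> irrelevant.\<close>
  have red: "(LINT x:I|lebesgue. u x) = integral {-N..N} u"
    if "continuous_on UNIV u" "\<And>x. x \<notin> K \<Longrightarrow> u x = 0" for u :: "real \<Rightarrow> real"
  proof -
    have "indicator I x *\<^sub>R u x = indicator {-N..N} x *\<^sub>R u x" for x
      using that(2)[of x] K(2) N[of x] by (cases "x \<in> K") (auto simp: indicator_def)
    then have "(LINT x:I|lebesgue. u x) = (LINT x:{-N..N}|lebesgue. u x)"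
      unfolding set_lebesgue_integral_def by presburger
    also have "\<dots> = integral {-N..N} u"
      by (intro set_lebesgue_integral_eq_integral absolutely_integrable_continuous_real
            continuous_on_subset[OF that(1)]) auto
    finally show ?thesis .
  qed
  have c1: "continuous_on UNIV (\<lambda>x. f x * deriv \<phi> x)" and c2: "continuous_on UNIV (\<lambda>x. f' x * \<phi> x)"
    by (intro continuous_intros c f')+
  have d: "((\<lambda>x. f x * \<phi> x) has_real_derivative f x * deriv \<phi> x + f' x * \<phi> x) (at x)" for x
    using DERIV_mult[OF f \<phi>] by (simp add: add.commute mult.commute)
  then have d': "((\<lambda>x. f x * \<phi> x) has_vector_derivative f x * deriv \<phi> x + f' x * \<phi> x)
      (at x within {-N..N})" for x
    unfolding has_real_derivative_iff_has_vector_derivative by (rule has_vector_derivative_at_within)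
  have "((\<lambda>x. f x * deriv \<phi> x + f' x * \<phi> x) has_integral (f N * \<phi> N - f (-N) * \<phi> (-N))) {-N..N}"
    by (rule fundamental_theorem_of_calculus[OF _ d']) (use N0 in simp)
  moreover have "\<phi> N = 0" "\<phi> (-N) = 0" using N[of N] N[of "-N"] N0 \<phi>0 by auto
  ultimately have "integral {-N..N} (\<lambda>x. f x * deriv \<phi> x + f' x * \<phi> x) = 0"
    by (simp add: integral_unique)
  moreover have "integral {-N..N} (\<lambda>x. f x * deriv \<phi> x + f' x * \<phi> x)
      = integral {-N..N} (\<lambda>x. f x * deriv \<phi> x) + integral {-N..N} (\<lambda>x. f' x * \<phi> x)"
    by (intro integral_add integrable_continuous_real continuous_on_subset[OF c1] continuous_on_subset[OF c2]) auto
  moreover have "(LINT x:I|lebesgue. f x * deriv \<phi> x) = integral {-N..N} (\<lambda>x. f x * deriv \<phi> x)"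
    by (rule red[OF c1]) (simp add: d0)
  moreover have "(LINT x:I|lebesgue. f' x * \<phi> x) = integral {-N..N} (\<lambda>x. f' x * \<phi> x)"
    by (rule red[OF c2]) (simp add: \<phi>0)
  ultimately show "(LINT x:I|lebesgue. f x * deriv \<phi> x) = - (LINT x:I|lebesgue. f' x * \<phi> x)"
    by linarith
qed

subsection \<open>Periodic orbits in angular coordinates\<close>

locale nls_power =
  fixes p :: real
  assumes p_gt_2: "p > 2"
begin

text \<open>
  On a positive energy level put \<open>v = m sin \<theta>\<close>, where \<open>m\<close> is the maximum of \<open>v\<close> and
  \<open>\<kappa> = 2 m\<^sup>p\<^sup>-\<^sup>2 / p > 1\<close>. Energy conservation becomes \<open>\<theta>' = speed \<kappa> \<theta>\<close>, an autonomous equation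
  whose right-hand side is continuous and positive even at the turning points of \<open>v\<close>.
\<close>

definition quot :: "real \<Rightarrow> real" where
  "quot y = (if y = 1 then p / 2 else (1 - y powr (p / 2)) / (1 - y))"

lemma quot_ge_1:
  assumes "0 \<le> y" "y \<le> 1"
  shows "1 \<le> quot y"
proof (cases "y = 1")
  case False
  have "y powr (p / 2) \<le> y powr 1" using assms p_gt_2 by (intro powr_mono') auto
  then show ?thesis using False assms unfolding quot_def by (auto simp: field_simps)
qed (use p_gt_2 in \<open>simp add: quot_def\<close>)

lemma continuous_on_quot: "continuous_on {0..1} quot"
  unfolding continuous_on_def
proof
  fix x :: real assume x: "x \<in> {0..1}"
  show "(quot \<longlongrightarrow> quot x) (at x within {0..1})"
  proof (cases "x = 1")
    case True
    \<comment> \<open>The value \<open>p / 2\<close> of \<open>quot\<close> at 1 is the derivative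
      there of the power in its numerator.\<close>
    have "((\<lambda>y. y powr (p / 2)) has_real_derivative p / 2 * 1 powr (p / 2 - 1)) (at 1 within {0..1})"
      by (rule has_field_derivative_at_within[OF has_real_derivative_powr]) simp
    then have "((\<lambda>y. (y powr (p / 2) - 1) / (y - 1)) \<longlongrightarrow> p / 2) (at 1 within {0..1})"
      by (simp add: has_field_derivative_iff)
    moreover have "\<forall>\<^sub>F y in at 1 within {0..1}. (y powr (p / 2) - 1) / (y - 1) = quot y"
      unfolding eventually_at_filter by (intro always_eventually) (auto simp: quot_def divide_simps algebra_simps)
    ultimately have "(quot \<longlongrightarrow> p / 2) (at 1 within {0..1})" by (rule Lim_transform_eventually)
    then show ?thesis using True by (simp add: quot_def)
  next
    case False
    have "((\<lambda>y. (1 - y powr (p / 2)) / (1 - y)) \<longlongrightarrow> (1 - x powr (p / 2)) / (1 - x)) (at x within {0..1})"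
      using False x p_gt_2
      by (intro tendsto_intros tendsto_powr') (auto simp: eventually_at_filter intro!: always_eventually)
    moreover have "\<forall>\<^sub>F y in at x within {0..1}. (1 - y powr (p / 2)) / (1 - y) = quot y"
    proof -
      have "\<forall>\<^sub>F y in at x within {0..1}. y \<in> - {1}"
        by (rule topological_tendstoD[OF tendsto_ident_at]) (use False in auto)
      then show ?thesis by eventually_elim (auto simp: quot_def)
    qed
    ultimately have "(quot \<longlongrightarrow> (1 - x powr (p / 2)) / (1 - x)) (at x within {0..1})"
      by (rule Lim_transform_eventually)
    then show ?thesis using False by (simp add: quot_def)
  qed
qed

lemma quot_bounded: "\<exists>B. \<forall>y\<in>{0..1}. quot y \<le> B"
  using continuous_attains_sup[OF _ _ continuous_on_quot] by force

text \<open>Energy conservation for \<open>m * sin \<theta>\<close> says that the square of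
  \<open>cos \<theta> * \<theta>'\<close> is \<open>\<kappa> * (1 - \<bar>sin \<theta>\<bar> powr p)
  - (cos \<theta>)\<^sup>2\<close>. Dividing by \<open>1 - (sin \<theta>)\<^sup>2\<close> gives the
  radicand; the value of \<open>quot\<close> at 1 removes the singularity at the turning
  points.\<close>

definition speed :: "real \<Rightarrow> real \<Rightarrow> real" where
  "speed \<kappa> \<theta> = sqrt (\<kappa> * quot ((sin \<theta>)\<^sup>2) - 1)"

lemma sin2_unit: "(sin \<theta>)\<^sup>2 \<in> {0..1::real}"
  by (simp add: abs_square_le_1)

lemma speed_ge:
  assumes "\<kappa> > 1"
  shows "sqrt (\<kappa> - 1) \<le> speed \<kappa> \<theta>"
proof -
  have "1 \<le> quot ((sin \<theta>)\<^sup>2)" using sin2_unit[of \<theta>] by (intro quot_ge_1) auto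
  then show ?thesis using assms mult_left_mono[of 1 "quot ((sin \<theta>)\<^sup>2)" \<kappa>]
    unfolding speed_def by simp
qed

lemma speed_pos: "\<kappa> > 1 \<Longrightarrow> speed \<kappa> \<theta> > 0"
  using speed_ge[of \<kappa> \<theta>] by (smt (verit) real_sqrt_gt_zero)

lemma speed_mono: "\<kappa> \<le> \<kappa>' \<Longrightarrow> speed \<kappa> \<theta> \<le> speed \<kappa>' \<theta>"
  using quot_ge_1[of "(sin \<theta>)\<^sup>2"] sin2_unit[of \<theta>] unfolding speed_def
  by (auto intro: mult_right_mono)

lemma continuous_on_quot_sin:
  fixes f :: "'b::t2_space \<Rightarrow> real"
  assumes "continuous_on S f"
  shows "continuous_on S (\<lambda>x. quot ((sin (f x))\<^sup>2))"
  by (rule continuous_on_compose2[OF continuous_on_quot])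
    (use sin2_unit in \<open>auto intro!: continuous_intros assms\<close>)

lemma continuous_on_speed [continuous_intros]:
  fixes f :: "'b::t2_space \<Rightarrow> real"
  assumes "continuous_on S f" "continuous_on S g"
  shows "continuous_on S (\<lambda>x. speed (f x) (g x))"
  unfolding speed_def by (intro continuous_intros assms continuous_on_quot_sin)

section \<open>Travel time along an orbit and its inverse\<close>

definition time :: "real \<Rightarrow> real \<Rightarrow> real" where
  "time \<kappa> \<theta> = \<theta> * integral {0..1} (\<lambda>t. 1 / speed \<kappa> (\<theta> * t))"

lemma time_0 [simp]: "time \<kappa> 0 = 0" by (simp add: time_def)

lemma has_real_derivative_time:
  "\<kappa> > 1 \<Longrightarrow> (time \<kappa> has_real_derivative 1 / speed \<kappa> \<theta>) (at \<theta>)"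
  unfolding time_def
  by (rule has_real_derivative_scaled_integral)
    (use speed_pos[of \<kappa>] in \<open>auto intro!: continuous_intros simp: less_imp_neq[THEN not_sym]\<close>)

lemma continuous_on_time_pair: "continuous_on ({1<..} \<times> UNIV) (\<lambda>z. time (fst z) (snd z))"
  unfolding time_def
proof (intro continuous_intros)
  have "continuous_on (({1<..} \<times> UNIV) \<times> cbox 0 1)
      (\<lambda>z. 1 / speed (fst (fst z)) (snd (fst z) * snd z))"
    using speed_pos by (auto intro!: continuous_intros simp: less_imp_neq[THEN not_sym])
  then have "continuous_on ({1<..} \<times> UNIV)
     (\<lambda>x. integral (cbox 0 1) (\<lambda>t. 1 / speed (fst x) (snd x * t)))"
    by (intro integral_continuous_on_param) (simp add: case_prod_unfold)
  then show "continuous_on ({1<..} \<times> UNIV)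
     (\<lambda>x. integral {0..1} (\<lambda>t. 1 / speed (fst x) (snd x * t)))" by simp
qed

lemma continuous_on_time [continuous_intros]:
  fixes f :: "'b::t2_space \<Rightarrow> real"
  assumes "continuous_on S f" "continuous_on S g" "\<And>x. x \<in> S \<Longrightarrow> f x > 1"
  shows "continuous_on S (\<lambda>x. time (f x) (g x))"
  using continuous_on_compose2[OF continuous_on_time_pair continuous_on_Pair[OF assms(1,2)]] assms(3)
  by auto

lemma strict_mono_time: "\<kappa> > 1 \<Longrightarrow> strict_mono (time \<kappa>)"
  by (rule strict_monoI, rule DERIV_pos_imp_increasing)
    (auto intro!: exI has_real_derivative_time speed_pos)

lemma time_less_iff: "\<kappa> > 1 \<Longrightarrow> time \<kappa> s < time \<kappa> t \<longleftrightarrow> s < t"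
  using strict_mono_time strict_mono_less by blast

lemma time_le_iff: "\<kappa> > 1 \<Longrightarrow> time \<kappa> s \<le> time \<kappa> t \<longleftrightarrow> s \<le> t"
  using strict_mono_time strict_mono_less_eq by blast

lemma time_le:
  assumes "\<kappa> > 1" "\<theta> \<ge> 0"
  shows "time \<kappa> \<theta> \<le> \<theta> / sqrt (\<kappa> - 1)"
proof -
  have "time \<kappa> \<theta> - \<theta> / sqrt (\<kappa> - 1) \<le> time \<kappa> 0 - 0 / sqrt (\<kappa> - 1)"
  proof (rule DERIV_nonpos_imp_nonincreasing[OF assms(2)])
    fix t
    show "\<exists>y. ((\<lambda>\<theta>. time \<kappa> \<theta> - \<theta> / sqrt (\<kappa> - 1)) has_real_derivative y) (at t) \<and> y \<le> 0"
      using speed_ge[OF assms(1), of t] assms(1) speed_pos[OF assms(1), of t]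
      by (intro exI[of _ "1 / speed \<kappa> t - 1 / sqrt (\<kappa> - 1)"])
        (auto intro!: DERIV_diff has_real_derivative_time DERIV_cdivide simp: frac_le)
  qed
  then show ?thesis by simp
qed

lemma time_antimono:
  assumes "1 < \<kappa>" "\<kappa> \<le> \<kappa>'" "\<theta> \<ge> 0"
  shows "time \<kappa>' \<theta> \<le> time \<kappa> \<theta>"
proof -
  have "time \<kappa>' \<theta> - time \<kappa> \<theta> \<le> time \<kappa>' 0 - time \<kappa> 0"
  proof (rule DERIV_nonpos_imp_nonincreasing[OF assms(3)])
    fix t
    show "\<exists>y. ((\<lambda>\<theta>. time \<kappa>' \<theta> - time \<kappa> \<theta>) has_real_derivative y) (at t) \<and> y \<le> 0"
      using speed_mono[OF assms(2), of t] assms speed_pos[OF assms(1), of t] 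
      by (intro exI[of _ "1 / speed \<kappa>' t - 1 / speed \<kappa> t"])
        (auto intro!: DERIV_diff has_real_derivative_time simp: frac_le)
  qed
  then show ?thesis by simp
qed

text \<open>Since \<open>quot\<close> is bounded on the unit interval, the speed is at most some
  \<open>V\<close>. Hence \<open>time\<close> grows at least like \<open>\<theta> / V\<close> in
  both directions.\<close>

lemma surj_time:
  assumes "\<kappa> > 1"
  shows "\<exists>\<theta>. time \<kappa> \<theta> = x"
proof -
  obtain B where B: "\<And>y. y \<in> {0..1} \<Longrightarrow> quot y \<le> B" using quot_bounded by blast
  define V where "V = sqrt (\<kappa> * B - 1)"
  have V: "speed \<kappa> \<theta> \<le> V" for \<theta>
    using B[OF sin2_unit[of \<theta>]] assms unfolding speed_def V_def by simp
  then have V0: "V > 0" using speed_pos[OF assms, of 0] by (smt (verit))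
  have mono: "time \<kappa> s - s / V \<le> time \<kappa> t - t / V" if "s \<le> t" for s t
  proof (rule DERIV_nonneg_imp_nondecreasing[OF that])
    fix t
    show "\<exists>y. ((\<lambda>\<theta>. time \<kappa> \<theta> - \<theta> / V) has_real_derivative y) (at t) \<and> 0 \<le> y"
      using V[of t] V0 speed_pos[OF assms, of t]
      by (intro exI[of _ "1 / speed \<kappa> t - 1 / V"])
        (auto intro!: DERIV_diff has_real_derivative_time DERIV_cdivide assms simp: frac_le)
  qed
  define N where "N = V * \<bar>x\<bar>"
  have N: "N \<ge> 0" "N / V = \<bar>x\<bar>" using V0 by (auto simp: N_def)
  have "time \<kappa> (-N) \<le> x" "x \<le> time \<kappa> N"
    using mono[of 0 N] mono[of "-N" 0] N by (simp_all add: abs_le_iff)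
  moreover have "continuous_on {-N..N} (time \<kappa>)" using assms by (auto intro!: continuous_intros)
  ultimately show ?thesis using IVT'[of "time \<kappa>" "-N" x N] N by auto
qed

text \<open>The solution of \<open>\<theta>' = speed \<kappa> \<theta>\<close> starting at angle 0,
  found by separation of variables rather than by an existence theorem.\<close>

definition ang :: "real \<Rightarrow> real \<Rightarrow> real" where
  "ang \<kappa> = inv (time \<kappa>)"

lemma ang_time: "\<kappa> > 1 \<Longrightarrow> ang \<kappa> (time \<kappa> \<theta>) = \<theta>"
  unfolding ang_def by (rule inv_f_f[OF strict_mono_imp_inj_on[OF strict_mono_time]])

lemma time_ang: "\<kappa> > 1 \<Longrightarrow> time \<kappa> (ang \<kappa> x) = x"
  unfolding ang_def by (rule f_inv_into_f) (use surj_time[of \<kappa> x] in blast)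

lemma ang_0 [simp]: "\<kappa> > 1 \<Longrightarrow> ang \<kappa> 0 = 0"
  using ang_time[of \<kappa> 0] by simp

lemma has_real_derivative_ang:
  assumes "\<kappa> > 1"
  shows "(ang \<kappa> has_real_derivative speed \<kappa> (ang \<kappa> x)) (at x)"
proof -
  have sm: "strict_mono (ang \<kappa>)"
    by (rule strict_monoI) (metis assms time_ang time_less_iff)
  have "isCont (ang \<kappa>) x"
  proof -
    have "isCont (ang \<kappa>) (time \<kappa> (ang \<kappa> x))"
      by (rule isCont_inverse_function[where d = 1])
        (use assms ang_time DERIV_isCont[OF has_real_derivative_time] in auto)
    then show ?thesis using time_ang[OF assms] by simp
  qed
  then have "(ang \<kappa> has_real_derivative inverse (1 / speed \<kappa> (ang \<kappa> x))) (at x)"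
    using has_real_derivative_time[OF assms, of "ang \<kappa> x"] speed_pos[OF assms, of "ang \<kappa> x"] time_ang[OF assms]
    by (intro DERIV_inverse_function[where f = "time \<kappa>" and a = "x - 1" and b = "x + 1"]) auto
  then show ?thesis by simp
qed

lemma ang_bounds:
  assumes "\<kappa> > 1" "x \<in> {0..time \<kappa> \<theta>}"
  shows "ang \<kappa> x \<in> {0..\<theta>}"
  using assms time_le_iff[OF assms(1), of 0 "ang \<kappa> x"] time_le_iff[OF assms(1), of "ang \<kappa> x" \<theta>]
  by (auto simp: time_ang)

section \<open>Amplitude and energy of an orbit\<close>

definition amp :: "real \<Rightarrow> real" where
  "amp \<kappa> = (p * \<kappa> / 2) powr (1 / (p - 2))"

lemma amp_less: "0 < \<kappa> \<Longrightarrow> \<kappa> < \<kappa>' \<Longrightarrow> amp \<kappa> < amp \<kappa>'"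
  using p_gt_2 unfolding amp_def by (intro powr_less_mono2) auto

lemma amp_gt_1: "\<kappa> > 1 \<Longrightarrow> amp \<kappa> > 1"
  using p_gt_2 powr_less_mono2[of "1 / (p - 2)" 1 "p * \<kappa> / 2"] mult_strict_mono[of 2 p 1 \<kappa>]
  unfolding amp_def by simp

lemma continuous_on_amp [continuous_intros]:
  fixes f :: "'b::t2_space \<Rightarrow> real"
  assumes "continuous_on S f" "\<And>x. x \<in> S \<Longrightarrow> f x > 0"
  shows "continuous_on S (\<lambda>x. amp (f x))"
  unfolding amp_def using assms(2) p_gt_2 by (auto intro!: continuous_intros assms(1)) force

lemma amp_powr: "\<kappa> > 0 \<Longrightarrow> amp \<kappa> powr (p - 2) = p * \<kappa> / 2"
  using p_gt_2 unfolding amp_def by (simp add: powr_powr)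

text \<open>\<open>energy \<kappa>\<close> is twice the conserved energy of the orbit with maximum \<open>amp \<kappa>\<close>.\<close>

definition energy :: "real \<Rightarrow> real" where
  "energy \<kappa> = (amp \<kappa>)\<^sup>2 * (\<kappa> - 1)"

lemma energy_pos: "\<kappa> > 1 \<Longrightarrow> energy \<kappa> > 0"
  using amp_gt_1[of \<kappa>] unfolding energy_def by simp

lemma energy_less: "1 < \<kappa> \<Longrightarrow> \<kappa> < \<kappa>' \<Longrightarrow> energy \<kappa> < energy \<kappa>'"
  using amp_gt_1[of \<kappa>] amp_less[of \<kappa> \<kappa>'] unfolding energy_def
  by (intro mult_strict_mono) (auto intro!: power_strict_mono)

lemma continuous_on_energy [continuous_intros]:
  fixes f :: "'b::t2_space \<Rightarrow> real"
  assumes "continuous_on S f" "\<And>x. x \<in> S \<Longrightarrow> f x > 1"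
  shows "continuous_on S (\<lambda>x. energy (f x))"
  unfolding energy_def using assms(2) by (auto intro!: continuous_intros assms(1)) force

lemma energy_small:
  assumes "c > 0"
  shows "\<exists>\<kappa>>1. energy \<kappa> \<le> c"
proof -
  \<comment> \<open>The cap 1 keeps \<open>\<kappa> \<le> 2\<close>, so the amplitude is at most
    \<open>amp 2\<close>; the other term then makes the product at most \<open>c\<close>.\<close>
  define \<kappa> where "\<kappa> = 1 + min 1 (c / (amp 2)\<^sup>2)"
  have a2: "amp 2 > 1" by (rule amp_gt_1) simp
  have \<kappa>: "1 < \<kappa>" "\<kappa> \<le> 2" using assms a2 unfolding \<kappa>_def by auto
  have "amp \<kappa> \<le> amp 2" using amp_less[of \<kappa> 2] \<kappa> by (cases "\<kappa> = 2") auto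
  then have "energy \<kappa> \<le> (amp 2)\<^sup>2 * (c / (amp 2)\<^sup>2)"
    using amp_gt_1[OF \<kappa>(1)] \<kappa> unfolding energy_def by (intro mult_mono) (auto simp: \<kappa>_def)
  then show ?thesis using \<kappa> a2 by auto
qed

lemma energy_large:
  assumes "c > 0"
  shows "\<exists>\<kappa>>1. c \<le> energy \<kappa>"
proof (intro exI conjI)
  have "1 * c \<le> (amp (1 + c))\<^sup>2 * c"
    using amp_gt_1[of "1 + c"] assms by (intro mult_right_mono) auto
  then show "c \<le> energy (1 + c)" by (simp add: energy_def)
qed (use assms in simp)

lemma energy_surj:
  assumes "c > 0"
  shows "\<exists>\<kappa>>1. energy \<kappa> = c"
proof -
  obtain k1 k2 where k: "k1 > 1" "energy k1 \<le> c" "k2 > 1" "c \<le> energy k2"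
    using energy_small[OF assms] energy_large[OF assms] by auto
  have "k1 \<le> k2" using energy_less[of k2 k1] k by (cases "k1 \<le> k2") auto
  moreover have "continuous_on {k1..k2} energy" using k by (auto intro!: continuous_intros)
  ultimately obtain \<kappa> where "k1 \<le> \<kappa>" "energy \<kappa> = c"
    using IVT'[of energy k1 c k2] k by blast
  then show ?thesis using k by (intro exI[of _ \<kappa>]) auto
qed

section \<open>The orbits as solutions of the differential equation\<close>

definition wave :: "real \<Rightarrow> real \<Rightarrow> real" where
  "wave \<kappa> x = amp \<kappa> * sin (ang \<kappa> x)"

definition wave_deriv :: "real \<Rightarrow> real \<Rightarrow> real" where
  "wave_deriv \<kappa> x = amp \<kappa> * (cos (ang \<kappa> x) * speed \<kappa> (ang \<kappa> x))"

lemma has_real_derivative_wave: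
  "\<kappa> > 1 \<Longrightarrow> (wave \<kappa> has_real_derivative wave_deriv \<kappa> x) (at x)"
  unfolding wave_def wave_deriv_def
  by (auto intro!: derivative_eq_intros has_real_derivative_ang)

lemma cos_speed_sq:
  assumes "\<kappa> > 1"
  shows "(cos \<theta> * speed \<kappa> \<theta>)\<^sup>2 = \<kappa> * (1 - \<bar>sin \<theta>\<bar> powr p) - (cos \<theta>)\<^sup>2"
proof -
  have "(speed \<kappa> \<theta>)\<^sup>2 = \<kappa> * quot ((sin \<theta>)\<^sup>2) - 1"
    using speed_pos[OF assms, of \<theta>] unfolding speed_def by simp
  moreover have "(cos \<theta>)\<^sup>2 * quot ((sin \<theta>)\<^sup>2) = 1 - \<bar>sin \<theta>\<bar> powr p"
  proof (cases "cos \<theta> = 0")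
    case True
    then have "\<bar>sin \<theta>\<bar> = 1" using sin_cos_squared_add[of \<theta>] by (simp add: abs_square_eq_1 power2_eq_1_iff)
    then show ?thesis using True by simp
  next
    case False
    then have "(sin \<theta>)\<^sup>2 \<noteq> 1" using sin_cos_squared_add[of \<theta>] by (metis add_cancel_right_right zero_eq_power2)
    moreover have "(sin \<theta>)\<^sup>2 powr (p / 2) = \<bar>sin \<theta>\<bar> powr p"
    proof (cases "sin \<theta> = 0")
      case False
      have "(sin \<theta>)\<^sup>2 = \<bar>sin \<theta>\<bar> powr 2" using False by (simp add: powr_numeral)
      then show ?thesis by (simp only: powr_powr) simp
    qed simp
    ultimately show ?thesis by (simp add: quot_def cos_squared_eq)
  qed
  ultimately show ?thesis by (simp only: power_mult_distrib) algebra
qed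

text \<open>Only continuity of \<open>quot\<close> is available, so the product with
  \<open>cos\<close> is differentiated as a whole: where \<open>cos \<theta>\<close> is nonzero, it
  is a signed square root of the explicit expression in \<open>cos_speed_sq\<close>.\<close>

lemma has_real_derivative_cos_speed:
  assumes "\<kappa> > 1"
  shows "((\<lambda>\<theta>. cos \<theta> * speed \<kappa> \<theta>) has_real_derivative
    (sin \<theta> - \<kappa> * p / 2 * (\<bar>sin \<theta>\<bar> powr (p - 2) * sin \<theta>)) / speed \<kappa> \<theta>) (at \<theta>)"
proof (cases "cos \<theta> = 0")
  case True
  text \<open>\<open>speed\<close> need not be differentiable here, but the factor \<open>cos\<close> vanishes.\<close>
  have "((\<lambda>y. (cos y - cos \<theta>) / (y - \<theta>)) \<longlongrightarrow> - sin \<theta>) (at \<theta>)"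
    using DERIV_cos[of \<theta>] by (simp add: has_field_derivative_iff)
  moreover have "(speed \<kappa> \<longlongrightarrow> speed \<kappa> \<theta>) (at \<theta>)"
    using continuous_on_speed[of UNIV "\<lambda>_. \<kappa>" "\<lambda>x. x"]
    by (auto simp: continuous_on_eq_continuous_at isCont_def)
  ultimately have "((\<lambda>y. (cos y - cos \<theta>) / (y - \<theta>) * speed \<kappa> y) \<longlongrightarrow> - sin \<theta> * speed \<kappa> \<theta>) (at \<theta>)"
    by (rule tendsto_mult)
  then have "((\<lambda>\<theta>. cos \<theta> * speed \<kappa> \<theta>) has_real_derivative - sin \<theta> * speed \<kappa> \<theta>) (at \<theta>)"
    using True by (simp add: has_field_derivative_iff)
  \<comment> \<open>At a turning point \<open>quot\<close> equals \<open>p / 2\<close>, hence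
    \<open>\<kappa> * p / 2\<close> is 1 plus the squared speed, and the two formulas agree.\<close>
  moreover have "- sin \<theta> * speed \<kappa> \<theta> = (sin \<theta> - \<kappa> * p / 2 * (\<bar>sin \<theta>\<bar> powr (p - 2) * sin \<theta>)) / speed \<kappa> \<theta>"
  proof -
    have s: "(sin \<theta>)\<^sup>2 = 1" using True sin_cos_squared_add[of \<theta>] by simp
    then have "\<bar>sin \<theta>\<bar> = 1" by (auto simp: power2_eq_1_iff)
    moreover have k: "\<kappa> * p / 2 = 1 + speed \<kappa> \<theta> * speed \<kappa> \<theta>"
      using speed_pos[OF assms, of \<theta>] s unfolding speed_def quot_def by simp
    ultimately show ?thesis using speed_pos[OF assms, of \<theta>]
      unfolding k by (simp add: field_simps)
  qed
  ultimately show ?thesis by simp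
next
  case False
  \<comment> \<open>On the open set \<open>S\<close> the cosine keeps the sign
    \<open>\<sigma>\<close>, so there the product equals
    \<open>\<sigma> * sqrt (R t)\<close>.\<close>
  define \<sigma> where "\<sigma> = sgn (cos \<theta>)"
  define R where "R = (\<lambda>\<theta>. \<kappa> * (1 - \<bar>sin \<theta>\<bar> powr p) - (cos \<theta>)\<^sup>2)"
  define S where "S = {t. 0 < \<sigma> * cos t}"
  have \<sigma>: "\<sigma> * \<sigma> = 1" "\<sigma> \<noteq> 0" using False by (auto simp: \<sigma>_def sgn_if)
  have S: "open S" "\<theta> \<in> S" using False
    by (auto simp: S_def \<sigma>_def sgn_if intro!: open_Collect_less continuous_intros)
  have eq: "\<sigma> * sqrt (R t) = cos t * speed \<kappa> t" if "t \<in> S" for t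
  proof -
    have "R t = (\<sigma> * cos t * speed \<kappa> t)\<^sup>2"
      unfolding R_def cos_speed_sq[OF assms, symmetric] using \<sigma>(1) by algebra
    moreover have "\<sigma> * cos t * speed \<kappa> t \<ge> 0" using that speed_pos[OF assms, of t] by (simp add: S_def)
    ultimately have "\<sigma> * sqrt (R t) = \<sigma> * (\<sigma> * cos t * speed \<kappa> t)" by simp
    then show ?thesis using \<sigma>(1) by (simp flip: mult.assoc)
  qed
  have Rpos: "R \<theta> > 0" using cos_speed_sq[OF assms, of \<theta>] False speed_pos[OF assms, of \<theta>]
    by (simp add: R_def flip: cos_speed_sq[OF assms]) 
  have dpow: "((\<lambda>t. \<bar>sin t\<bar> powr p) has_real_derivative (p * (\<bar>sin \<theta>\<bar> powr (p - 2) * sin \<theta>)) * cos \<theta>) (at \<theta>)"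
    by (rule DERIV_chain2[where f = "\<lambda>x. \<bar>x\<bar> powr p", OF has_real_derivative_abs_powr DERIV_sin]) (use p_gt_2 in simp)
  have "(R has_real_derivative - (\<kappa> * ((p * (\<bar>sin \<theta>\<bar> powr (p - 2) * sin \<theta>)) * cos \<theta>)) + 2 * cos \<theta> * sin \<theta>) (at \<theta>)"
    (is "(R has_real_derivative ?R') _")
    unfolding R_def
    by (rule DERIV_cong[OF DERIV_diff[OF DERIV_cmult[OF DERIV_diff[OF DERIV_const dpow]] DERIV_power[OF DERIV_cos]]])
      simp
  then have "((\<lambda>t. \<sigma> * sqrt (R t)) has_real_derivative \<sigma> * (?R' * (inverse (sqrt (R \<theta>)) / 2))) (at \<theta>)"
    using Rpos by (auto intro!: derivative_eq_intros)
  moreover have "\<sigma> * (?R' * (inverse (sqrt (R \<theta>)) / 2)) = (sin \<theta> - \<kappa> * p / 2 * (\<bar>sin \<theta>\<bar> powr (p - 2) * sin \<theta>)) / speed \<kappa> \<theta>"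
  proof -
    have "sqrt (R \<theta>) = \<sigma> * (cos \<theta> * speed \<kappa> \<theta>)"
      using eq[OF S(2)] \<sigma>(1) by (metis mult.assoc mult_1)
    then show ?thesis using \<sigma> False speed_pos[OF assms, of \<theta>] by (simp add: field_simps)
  qed
  ultimately have "((\<lambda>t. \<sigma> * sqrt (R t)) has_real_derivative
      (sin \<theta> - \<kappa> * p / 2 * (\<bar>sin \<theta>\<bar> powr (p - 2) * sin \<theta>)) / speed \<kappa> \<theta>) (at \<theta>)" by (simp only:)
  then show ?thesis
    by (rule has_field_derivative_transform_within_open[OF _ S eq])
qed

text \<open>The factor \<open>speed\<close> from the chain rule cancels the denominator, and
  \<open>amp_powr\<close> turns the coefficient \<open>\<kappa> * p / 2\<close> into the power of
  the amplitude that the nonlinearity needs.\<close>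

lemma has_real_derivative_wave_deriv:
  assumes "\<kappa> > 1"
  shows "(wave_deriv \<kappa> has_real_derivative
    wave \<kappa> x - \<bar>wave \<kappa> x\<bar> powr (p - 2) * wave \<kappa> x) (at x)"
proof -
  have "((\<lambda>x. amp \<kappa> * (cos (ang \<kappa> x) * speed \<kappa> (ang \<kappa> x))) has_real_derivative
    amp \<kappa> * ((sin (ang \<kappa> x) - \<kappa> * p / 2 * (\<bar>sin (ang \<kappa> x)\<bar> powr (p - 2) * sin (ang \<kappa> x)))
      / speed \<kappa> (ang \<kappa> x) * speed \<kappa> (ang \<kappa> x))) (at x)"
    by (intro DERIV_cmult DERIV_chain2[where f = "\<lambda>\<theta>. cos \<theta> * speed \<kappa> \<theta>"]
        has_real_derivative_cos_speed has_real_derivative_ang assms)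
  moreover have "\<bar>wave \<kappa> x\<bar> powr (p - 2) = p * \<kappa> / 2 * \<bar>sin (ang \<kappa> x)\<bar> powr (p - 2)"
    using amp_powr[of \<kappa>] amp_gt_1[OF assms] assms by (simp add: wave_def abs_mult powr_mult)
  moreover from this have "amp \<kappa> * ((sin (ang \<kappa> x) - \<kappa> * p / 2 * (\<bar>sin (ang \<kappa> x)\<bar> powr (p - 2) * sin (ang \<kappa> x)))
      / speed \<kappa> (ang \<kappa> x) * speed \<kappa> (ang \<kappa> x)) = wave \<kappa> x - \<bar>wave \<kappa> x\<bar> powr (p - 2) * wave \<kappa> x"
    using speed_pos[OF assms, of "ang \<kappa> x"] by (simp add: wave_def[of \<kappa> x] field_simps)
  ultimately show ?thesis unfolding wave_deriv_def[abs_def] by simp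
qed

text \<open>Conservation of energy, a rescaling of \<open>cos_speed_sq\<close>. At zeros of the wave
  the squared slope is \<open>energy \<kappa>\<close>.\<close>

lemma wave_deriv_sq:
  assumes "\<kappa> > 1"
  shows "(wave_deriv \<kappa> x)\<^sup>2 = energy \<kappa> + (wave \<kappa> x)\<^sup>2 - 2 / p * \<bar>wave \<kappa> x\<bar> powr p"
proof -
  have "amp \<kappa> powr p = amp \<kappa> powr (p - 2) * (amp \<kappa>)\<^sup>2"
    using amp_gt_1[OF assms] powr_add[of "amp \<kappa>" "p - 2" 2] by (simp add: powr_numeral)
  then have *: "2 / p * \<bar>wave \<kappa> x\<bar> powr p = (amp \<kappa>)\<^sup>2 * \<kappa> * \<bar>sin (ang \<kappa> x)\<bar> powr p"
    using amp_powr[of \<kappa>] amp_gt_1[OF assms] assms p_gt_2 by (simp add: wave_def abs_mult powr_mult field_simps)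
  show ?thesis
    unfolding * unfolding wave_deriv_def power_mult_distrib[of "amp \<kappa>"] cos_speed_sq[OF assms]
    by (simp add: wave_def energy_def power_mult_distrib cos_squared_eq algebra_simps)
qed

lemma wave_0 [simp]: "\<kappa> > 1 \<Longrightarrow> wave \<kappa> 0 = 0"
  by (simp add: wave_def)

lemma wave_time: "\<kappa> > 1 \<Longrightarrow> wave \<kappa> (time \<kappa> \<theta>) = amp \<kappa> * sin \<theta>"
  by (simp add: wave_def ang_time)

lemma wave_nonneg:
  assumes "\<kappa> > 1" "\<theta> \<le> pi" "x \<in> {0..time \<kappa> \<theta>}"
  shows "wave \<kappa> x \<ge> 0"
  using ang_bounds[OF assms(1,3)] assms(2) amp_gt_1[OF assms(1)]
  unfolding wave_def by (auto intro!: mult_nonneg_nonneg sin_ge_zero)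

subsection \<open>Matching the edges at the origin\<close>

text \<open>The squared slope at height \<open>a\<close> on the zero energy level, which is the
  level of the soliton.\<close>

definition potential :: "real \<Rightarrow> real" where
  "potential a = a\<^sup>2 - 2 / p * \<bar>a\<bar> powr p"

lemma potential_bounds:
  assumes "0 \<le> a" "a \<le> 1"
  shows "0 \<le> potential a" "potential a \<le> a\<^sup>2"
proof -
  have "a powr p \<le> a powr 2" using assms p_gt_2 by (intro powr_mono') auto
  then have "2 / p * a powr p \<le> 1 * a\<^sup>2" using assms p_gt_2 by (intro mult_mono) (auto simp: powr_numeral)
  then show "0 \<le> potential a" using assms by (simp add: potential_def)
  show "potential a \<le> a\<^sup>2" using p_gt_2 by (simp add: potential_def)
qed

lemma continuous_on_potential [continuous_intros]:
  fixes f :: "'b::t2_space \<Rightarrow> real"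
  assumes "continuous_on S f"
  shows "continuous_on S (\<lambda>x. potential (f x))"
  unfolding potential_def using p_gt_2
  by (intro continuous_intros continuous_on_powr' assms) auto

text \<open>As long as the wave stays in the interval from 0 to 1 its second derivative is
  nonnegative, so its slope increases. The mean slope therefore lies between the initial slope,
  whose square is the energy, and the final slope.\<close>

lemma wave_convex_bounds:
  assumes "\<kappa> > 1" "0 < \<theta>" "\<theta> \<le> pi / 2" "amp \<kappa> * sin \<theta> \<le> 1"
  shows "energy \<kappa> * (time \<kappa> \<theta>)\<^sup>2 \<le> (amp \<kappa> * sin \<theta>)\<^sup>2"
    and "amp \<kappa> * sin \<theta> \<le> time \<kappa> \<theta> * wave_deriv \<kappa> (time \<kappa> \<theta>)"
proof -
  define l where "l = time \<kappa> \<theta>"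
  have l: "l > 0" using time_less_iff[OF assms(1), of 0 \<theta>] assms(2) by (simp add: l_def)
  have mono: "wave_deriv \<kappa> s \<le> wave_deriv \<kappa> t" if "0 \<le> s" "s \<le> t" "t \<le> l" for s t
  proof (rule DERIV_nonneg_imp_nondecreasing[OF that(2)])
    fix x assume x: "s \<le> x" "x \<le> t"
    have w0: "0 \<le> wave \<kappa> x" using assms x that by (intro wave_nonneg[of \<kappa> \<theta>]) (auto simp: l_def)
    have "ang \<kappa> x \<in> {0..\<theta>}" using x that by (intro ang_bounds assms) (auto simp: l_def)
    then have "sin (ang \<kappa> x) \<le> sin \<theta>" using assms by (intro sin_monotone_2pi_le) auto
    then have w1: "wave \<kappa> x \<le> 1" using assms(4) amp_gt_1[OF assms(1)] mult_left_mono[of "sin (ang \<kappa> x)" "sin \<theta>" "amp \<kappa>"]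
      unfolding wave_def by linarith
    have "\<bar>wave \<kappa> x\<bar> powr (p - 2) * wave \<kappa> x \<le> 1 * wave \<kappa> x"
      using w0 w1 p_gt_2 by (intro mult_right_mono powr_le1) auto
    then show "\<exists>y. (wave_deriv \<kappa> has_real_derivative y) (at x) \<and> 0 \<le> y"
      using has_real_derivative_wave_deriv[OF assms(1), of x] by (intro exI conjI) auto
  qed
  obtain z where z: "0 < z" "z < l" "wave \<kappa> l - wave \<kappa> 0 = (l - 0) * wave_deriv \<kappa> z"
    using MVT2[OF l has_real_derivative_wave[OF assms(1)]] by blast
  then have eq: "amp \<kappa> * sin \<theta> = l * wave_deriv \<kappa> z" using wave_time[OF assms(1)] assms(1) by (simp add: l_def)
  show "amp \<kappa> * sin \<theta> \<le> time \<kappa> \<theta> * wave_deriv \<kappa> (time \<kappa> \<theta>)"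
    unfolding eq unfolding l_def[symmetric] using mono[of z l] z l by (intro mult_left_mono) auto
  have "wave_deriv \<kappa> 0 > 0" using amp_gt_1[OF assms(1)] speed_pos[OF assms(1), of 0] assms(1)
    unfolding wave_deriv_def by simp
  moreover have "(wave_deriv \<kappa> 0)\<^sup>2 = energy \<kappa>" using wave_deriv_sq[OF assms(1), of 0] assms(1) p_gt_2 by simp
  moreover have "(l * wave_deriv \<kappa> 0)\<^sup>2 \<le> (l * wave_deriv \<kappa> z)\<^sup>2"
    using calculation mono[of 0 z] z l by (intro power_mono mult_left_mono) auto
  ultimately show "energy \<kappa> * (time \<kappa> \<theta>)\<^sup>2 \<le> (amp \<kappa> * sin \<theta>)\<^sup>2"
    unfolding eq unfolding l_def[symmetric] by (simp add: power_mult_distrib mult.commute)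
qed

text \<open>A Gronwall argument shows that small energy forces a long quarter period: with
  \<open>s = sqrt (energy \<kappa>)\<close> the slope is at most \<open>wave \<kappa> x + s\<close>,
  so \<open>(wave \<kappa> x + s) * exp (- x)\<close> does not increase from its initial value
  \<open>s\<close>, while the wave has to climb to \<open>amp \<kappa> > 1\<close>.\<close>

lemma exp_time_le:
  assumes "\<kappa> > 1"
  shows "exp (- time \<kappa> (pi / 2)) \<le> sqrt (energy \<kappa>)"
proof -
  define T s where "T = time \<kappa> (pi / 2)" and "s = sqrt (energy \<kappa>)"
  have s: "s > 0" "s\<^sup>2 = energy \<kappa>" using energy_pos[OF assms] by (auto simp: s_def)
  have T: "T \<ge> 0" using time_le_iff[OF assms, of 0 "pi / 2"] by (simp add: T_def)
  have "(wave \<kappa> T + s) * exp (- T) \<le> (wave \<kappa> 0 + s) * exp (- 0)"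
  proof (rule DERIV_nonpos_imp_nonincreasing[OF T])
    fix x assume x: "0 \<le> x" "x \<le> T"
    have w0: "0 \<le> wave \<kappa> x" using x assms by (intro wave_nonneg[of \<kappa> "pi / 2"]) (auto simp: T_def)
    have "(wave_deriv \<kappa> x)\<^sup>2 \<le> energy \<kappa> + (wave \<kappa> x)\<^sup>2"
      unfolding wave_deriv_sq[OF assms] using p_gt_2 by simp
    also have "\<dots> \<le> (wave \<kappa> x + s)\<^sup>2" using w0 s by (simp add: power2_sum)
    finally have "wave_deriv \<kappa> x \<le> wave \<kappa> x + s" by (rule power2_le_imp_le) (use w0 s in simp)
    then have "(wave_deriv \<kappa> x - (wave \<kappa> x + s)) * exp (- x) \<le> 0"
      by (intro mult_nonpos_nonneg) auto
    moreover have "((\<lambda>x. exp (- x)) has_real_derivative - exp (- x)) (at x)"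
      using DERIV_fun_exp[OF DERIV_minus[OF DERIV_ident]] by simp
    from DERIV_mult[OF DERIV_add[OF has_real_derivative_wave[OF assms] DERIV_const] this]
    have "((\<lambda>x. (wave \<kappa> x + s) * exp (- x)) has_real_derivative
        (wave_deriv \<kappa> x - (wave \<kappa> x + s)) * exp (- x)) (at x)"
      by (rule DERIV_cong) (simp add: algebra_simps)
    ultimately show "\<exists>y. ((\<lambda>x. (wave \<kappa> x + s) * exp (- x)) has_real_derivative y) (at x) \<and> y \<le> 0"
      by blast
  qed
  then have "(amp \<kappa> + s) * exp (- T) \<le> s" using assms wave_time[OF assms, of "pi / 2"] by (simp add: T_def)
  moreover have "1 * exp (- T) \<le> (amp \<kappa> + s) * exp (- T)"
    using amp_gt_1[OF assms] s by (intro mult_right_mono) auto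
  ultimately have "1 * exp (- T) \<le> s" by linarith
  then show ?thesis by (simp add: T_def s_def)
qed

text \<open>The time that the orbit of parameter \<open>\<kappa>\<close>, rising from \<open>0\<close>, needs to reach the height \<open>a\<close>.\<close>

definition rise :: "real \<Rightarrow> real \<Rightarrow> real" where
  "rise a \<kappa> = time \<kappa> (arcsin (a / amp \<kappa>))"

lemma arcsin_height:
  assumes "0 < a" "a \<le> 1" "\<kappa> > 1"
  shows "0 < arcsin (a / amp \<kappa>)" "arcsin (a / amp \<kappa>) < pi / 2" "amp \<kappa> * sin (arcsin (a / amp \<kappa>)) = a"
proof -
  have "0 < a / amp \<kappa>" "a / amp \<kappa> < 1" "amp \<kappa> > 0" using assms amp_gt_1[OF assms(3)] by auto
  then show "0 < arcsin (a / amp \<kappa>)" "arcsin (a / amp \<kappa>) < pi / 2" "amp \<kappa> * sin (arcsin (a / amp \<kappa>)) = a"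
    using arcsin_less_arcsin[of 0 "a / amp \<kappa>"] arcsin_less_arcsin[of "a / amp \<kappa>" 1] by auto
qed

text \<open>Two effects add up: a larger amplitude lowers the angle at which height \<open>a\<close>
  is reached, and a larger \<open>\<kappa>\<close> means higher speed.\<close>

lemma rise_antimono:
  assumes "0 < a" "a \<le> 1" "1 < \<kappa>" "\<kappa> < \<kappa>'"
  shows "rise a \<kappa>' < rise a \<kappa>"
proof -
  have 1: "amp \<kappa> > 1" "amp \<kappa> < amp \<kappa>'" using assms amp_gt_1 amp_less[of \<kappa> \<kappa>'] by auto
  have "0 < a / amp \<kappa>'" "a / amp \<kappa>' < a / amp \<kappa>" "a / amp \<kappa> < 1" using assms 1 by (auto simp: frac_less2)
  then have "arcsin (a / amp \<kappa>') < arcsin (a / amp \<kappa>)"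
    by (intro arcsin_less_arcsin) auto
  then have "time \<kappa> (arcsin (a / amp \<kappa>')) < time \<kappa> (arcsin (a / amp \<kappa>))"
    using time_less_iff assms by simp
  moreover have "time \<kappa>' (arcsin (a / amp \<kappa>')) \<le> time \<kappa> (arcsin (a / amp \<kappa>'))"
    using assms arcsin_height(1)[of a \<kappa>'] by (intro time_antimono) auto
  ultimately show ?thesis by (simp add: rise_def)
qed

lemma continuous_on_height_ratio:
  fixes f :: "'b::t2_space \<Rightarrow> real"
  assumes "continuous_on S f" "continuous_on S g" "\<And>x. x \<in> S \<Longrightarrow> 0 < f x \<and> f x \<le> 1 \<and> g x > 1"
  shows "continuous_on S (\<lambda>x. arcsin (f x / amp (g x)))"
proof (rule continuous_on_arcsin)
  show "continuous_on S (\<lambda>x. f x / amp (g x))"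
    using assms(3) amp_gt_1 by (intro continuous_intros assms) force+
  show "\<forall>x\<in>S. - 1 \<le> f x / amp (g x) \<and> f x / amp (g x) \<le> 1"
  proof
    fix x assume "x \<in> S"
    then have "0 < f x / amp (g x)" "f x / amp (g x) < 1" using assms(3)[of x] amp_gt_1[of "g x"] by auto
    then show "- 1 \<le> f x / amp (g x) \<and> f x / amp (g x) \<le> 1" by linarith
  qed
qed

lemma rise_bounds:
  assumes "0 < a" "a \<le> 1" "\<kappa> > 1" 
  shows "0 < rise a \<kappa>" "energy \<kappa> * (rise a \<kappa>)\<^sup>2 \<le> a\<^sup>2"
    "a \<le> rise a \<kappa> * sqrt (energy \<kappa> + potential a)"
    "wave_deriv \<kappa> (rise a \<kappa>) = sqrt (energy \<kappa> + potential a)"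
proof -
  note h = arcsin_height[OF assms]
  have b: "energy \<kappa> * (rise a \<kappa>)\<^sup>2 \<le> a\<^sup>2" "a \<le> rise a \<kappa> * wave_deriv \<kappa> (rise a \<kappa>)"
    using wave_convex_bounds[OF assms(3) h(1)] h assms by (auto simp: rise_def)
  show r: "0 < rise a \<kappa>" using h(1) time_less_iff[OF assms(3), of 0] assms(3) by (simp add: rise_def)
  have "0 < rise a \<kappa> * wave_deriv \<kappa> (rise a \<kappa>)" using b(2) assms by linarith
  then have "wave_deriv \<kappa> (rise a \<kappa>) > 0" using r by (simp add: zero_less_mult_iff)
  moreover have "(wave_deriv \<kappa> (rise a \<kappa>))\<^sup>2 = energy \<kappa> + potential a"
    using wave_deriv_sq[OF assms(3)] wave_time[OF assms(3)] h(3) by (simp add: rise_def potential_def)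
  ultimately show "wave_deriv \<kappa> (rise a \<kappa>) = sqrt (energy \<kappa> + potential a)"
    by (intro real_sqrt_unique[symmetric]) auto
  then show "a \<le> rise a \<kappa> * sqrt (energy \<kappa> + potential a)" using b by simp
  show "energy \<kappa> * (rise a \<kappa>)\<^sup>2 \<le> a\<^sup>2" by fact
qed

lemma rise_surj:
  assumes "0 < a" "a \<le> 1" "0 < l" "l \<le> 1 / 4"
  shows "\<exists>\<kappa>>1. rise a \<kappa> = l"
proof -
  \<comment> \<open>At this energy the slope at height \<open>a\<close> is at most
    \<open>sqrt 2 * a\<close>, and convexity then makes the rise last at least
    \<open>1 / sqrt 2\<close>, which exceeds 1/4.\<close>
  obtain k1 where k1: "k1 > 1" "energy k1 \<le> a\<^sup>2" using energy_small[of "a\<^sup>2"] assms by auto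
  have r1: "l \<le> rise a k1"
  proof (rule ccontr)
    assume "\<not> l \<le> rise a k1"
    then have "rise a k1 < 1 / 4" using assms by linarith
    then have "rise a k1 * sqrt (energy k1 + potential a) \<le> 1 / 4 * sqrt (2 * a\<^sup>2)"
      using rise_bounds(1)[OF assms(1,2) k1(1)] k1 energy_pos[OF k1(1)] potential_bounds[of a] assms
      by (intro mult_mono real_sqrt_le_mono) auto
    also have "1 / 4 * sqrt (2 * a\<^sup>2) < a"
      using assms real_sqrt_less_mono[of 2 "4"] by (simp add: real_sqrt_mult)
    finally show False using rise_bounds(3)[OF assms(1,2) k1(1)] by linarith
  qed
  \<comment> \<open>The angle is below \<open>pi / 2\<close> and the speed at least
    \<open>sqrt (k2 - 1) = pi / 2 / l\<close>, so the rise takes at most \<open>l\<close>.\<close>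
  define k2 where "k2 = 1 + (pi / 2 / l)\<^sup>2"
  have k2: "k2 > 1" using assms by (simp add: k2_def)
  have "rise a k2 \<le> arcsin (a / amp k2) / sqrt (k2 - 1)"
    unfolding rise_def using arcsin_height[OF assms(1,2) k2] by (intro time_le k2) auto
  also have "sqrt (k2 - 1) = pi / 2 / l" using assms by (simp add: k2_def)
  also have "arcsin (a / amp k2) / (pi / 2 / l) \<le> (pi / 2) / (pi / 2 / l)"
    using arcsin_height[OF assms(1,2) k2] assms by (intro divide_right_mono) auto
  finally have r2: "rise a k2 \<le> l" by simp
  have "k1 \<le> k2" using rise_antimono[OF assms(1,2), of k2 k1] k2 r1 r2 by (cases "k1 \<le> k2") auto
  moreover have "continuous_on {k1..k2} (rise a)" unfolding rise_def
    using k1 assms by (intro continuous_intros continuous_on_height_ratio) auto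
  ultimately obtain \<kappa> where "k1 \<le> \<kappa>" "rise a \<kappa> = l" using IVT2'[of "rise a" k2 l k1] r1 r2 by blast
  then show ?thesis using k1 by (intro exI[of _ \<kappa>]) auto
qed

text \<open>
  The sign \<open>\<sigma>\<close> selects the decaying half-soliton (\<open>\<sigma> = 1\<close>) or the one with an interior maximum
  (\<open>\<sigma> = - 1\<close>). Every \<open>a\<close> determines \<open>\<kappa>1\<close> by the length of the short edge and then \<open>\<kappa>2\<close> by the
  Kirchhoff condition; \<open>a\<close> itself is found by the intermediate value theorem for the length of
  the long edge, which tends to infinity as \<open>a\<close> tends to \<open>0\<close>.
\<close>

lemma edge_balance:
  assumes l1: "0 < l1" "l1 \<le> 1 / 4" and k: "k > 1" "energy k \<le> 8" "pi / sqrt (k - 1) < l2"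
    and \<sigma>: "\<sigma> = 1 \<or> \<sigma> = - 1"
  shows "\<exists>a \<kappa>1 \<kappa>2. 0 < a \<and> a \<le> 1 \<and> 1 < \<kappa>1 \<and> 1 < \<kappa>2 \<and>
    l1 = time \<kappa>1 (arcsin (a / amp \<kappa>1)) \<and> l2 = time \<kappa>2 (pi - arcsin (a / amp \<kappa>2)) \<and>
    \<sigma> * sqrt (potential a) + wave_deriv \<kappa>1 l1 + wave_deriv \<kappa>2 l2 = 0"
proof -
  have "\<forall>a\<in>{0<..1}. \<exists>\<kappa>. \<kappa> > 1 \<and> rise a \<kappa> = l1" using rise_surj l1 by auto
  then obtain k1 where k1: "\<And>a. a \<in> {0<..1} \<Longrightarrow> k1 a > 1 \<and> rise a (k1 a) = l1" by metis
  \<comment> \<open>Here \<open>r\<close> and \<open>D\<close> are the absolute slopes at the origin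
    on the half-line and on the short edge. The Kirchhoff condition asks for the slope
    \<open>D a + \<sigma> * r a\<close> on the long edge; its square minus
    \<open>potential a\<close> is the energy \<open>c a\<close>.\<close>
  define r where "r = (\<lambda>a. sqrt (potential a))"
  define D where "D = (\<lambda>a. sqrt (energy (k1 a) + potential a))"
  define c where "c = (\<lambda>a. (D a)\<^sup>2 + 2 * \<sigma> * r a * D a)"
  have r: "0 \<le> r a" "r a \<le> a" if "a \<in> {0<..1}" for a
    using potential_bounds[of a] that real_sqrt_le_mono[of "potential a" "a\<^sup>2"] by (auto simp: r_def)
  have D: "a / l1 \<le> D a" "(D a)\<^sup>2 = energy (k1 a) + potential a" "(D a)\<^sup>2 \<le> (1 / l1\<^sup>2 + 1) * a\<^sup>2"
    "wave_deriv (k1 a) l1 = D a" if "a \<in> {0<..1}" for a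
  proof -
    note b = rise_bounds[of a "k1 a"]
    show "a / l1 \<le> D a" using b(3) k1[OF that] that l1 by (simp add: D_def field_simps)
    show D2: "(D a)\<^sup>2 = energy (k1 a) + potential a"
      using energy_pos[of "k1 a"] k1[OF that] potential_bounds[of a] that by (simp add: D_def)
    have "energy (k1 a) \<le> a\<^sup>2 / l1\<^sup>2" using b(2) k1[OF that] that l1 by (simp add: field_simps)
    then show "(D a)\<^sup>2 \<le> (1 / l1\<^sup>2 + 1) * a\<^sup>2" unfolding D2
      using potential_bounds[of a] that by (simp add: algebra_simps)
    show "wave_deriv (k1 a) l1 = D a" using b(4) k1[OF that] that by (simp add: D_def)
  qed
  \<comment> \<open>Together with \<open>r a \<le> a\<close> this makes the cross term in
    \<open>c\<close> at most half of \<open>(D a)\<^sup>2\<close>, so that \<open>c\<close> is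
    positive for either sign.\<close>
  have D4: "4 * a \<le> D a" if "a \<in> {0<..1}" for a
  proof -
    have "4 * a \<le> a / l1" using that l1 by (simp add: field_simps)
    then show ?thesis using D(1)[OF that] by simp
  qed
  have c: "0 < c a" "(D a)\<^sup>2 / 2 \<le> c a" "c a \<le> 3 * (D a)\<^sup>2" "0 < D a + \<sigma> * r a" if "a \<in> {0<..1}" for a
  proof -
    have D0: "D a > 0" "4 * r a \<le> D a" using D4[OF that] r(2)[OF that] that by auto
    have "r a * D a \<le> (D a / 4) * D a" using D0 by (intro mult_right_mono) auto
    moreover have "0 \<le> r a * D a" using D0 r(1)[OF that] by simp
    moreover have "0 < (D a)\<^sup>2" using D0 by simp
    ultimately show "0 < c a" "(D a)\<^sup>2 / 2 \<le> c a" "c a \<le> 3 * (D a)\<^sup>2" 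
      using \<sigma> unfolding c_def by (auto simp: power2_eq_square)
    show "0 < D a + \<sigma> * r a" using \<sigma> D0 r(1)[OF that] by auto
  qed
  have ck1: "continuous_on {0<..1} k1"
  proof (rule continuous_on_implicit_antimono[where b = 1 and F = rise and z = "\<lambda>_. l1"])
    show "continuous_on {0<..1} (\<lambda>a. rise a t)" if "1 < t" for t
      unfolding rise_def using that by (intro continuous_intros continuous_on_height_ratio) auto
  qed (use k1 rise_antimono in auto)
  have cc: "continuous_on {0<..1} c"
    unfolding c_def D_def r_def using k1 by (intro continuous_intros ck1) auto
  have "\<forall>a\<in>{0<..1}. \<exists>\<kappa>. \<kappa> > 1 \<and> energy \<kappa> = c a" using energy_surj c(1) by blast
  then obtain k2 where k2: "\<And>a. a \<in> {0<..1} \<Longrightarrow> k2 a > 1 \<and> energy (k2 a) = c a" by metis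
  have ck2: "continuous_on {0<..1} k2"
  \<comment> \<open>The energy increases with its parameter, hence the minus signs.\<close>
  proof (rule continuous_on_implicit_antimono[where b = 1 and F = "\<lambda>_ t. - energy t" and z = "\<lambda>a. - c a"])
  qed (use k2 energy_less cc in \<open>auto intro!: continuous_intros\<close>)
  define S where "S = (\<lambda>a. time (k2 a) (pi - arcsin (a / amp (k2 a))))"
  have cS: "continuous_on {0<..1} S"
    unfolding S_def using k2 by (intro continuous_intros continuous_on_height_ratio ck2) auto
  \<comment> \<open>At \<open>a = 1\<close> the energy is at least \<open>4\<^sup>2 / 2\<close>,
    whatever \<open>l1\<close> is. This is the origin of the constant 8 in the hypothesis on
    \<open>k\<close>.\<close>
  have "8 \<le> energy (k2 1)"
  proof -
    have "4\<^sup>2 \<le> (D 1)\<^sup>2" using D4[of 1] by (intro power_mono) auto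
    then show ?thesis using c(2)[of 1] k2[of 1] by simp
  qed
  then have k21: "k \<le> k2 1" using energy_less[of "k2 1" k] k k2[of 1] by (cases "k \<le> k2 1") auto
  have S1: "S 1 \<le> l2"
  proof -
    have h: "0 < arcsin (1 / amp (k2 1))" "arcsin (1 / amp (k2 1)) < pi / 2"
      using arcsin_height[of 1 "k2 1"] k2[of 1] by auto
    have "S 1 \<le> (pi - arcsin (1 / amp (k2 1))) / sqrt (k2 1 - 1)"
      unfolding S_def using h k2[of 1] by (intro time_le) auto
    also have "\<dots> \<le> pi / sqrt (k - 1)" using h k k21 by (intro frac_le) auto
    finally show ?thesis using k(3) by simp
  qed
  \<comment> \<open>By the upper bounds on \<open>c\<close> and \<open>D\<close>, the square root of
    the energy is at most \<open>q * a\<close>. At \<open>a0\<close> this is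
    \<open>exp (- l2)\<close>, so by \<open>exp_time_le\<close> the rise to the maximum alone takes
    at least \<open>l2\<close>.\<close>
  define q where "q = sqrt (3 * (1 / l1\<^sup>2 + 1))"
  define a0 where "a0 = exp (- l2) / q"
  have q: "q \<ge> 1" unfolding q_def by (intro real_sqrt_ge_one) simp
  have l2: "l2 > 0" using k by (intro less_trans[OF _ k(3)]) simp
  have a0: "0 < a0" "a0 \<le> 1" using q order_trans[of "exp (- l2)" 1 q] l2 by (auto simp: a0_def divide_le_eq)
  have S0: "l2 \<le> S a0"
  proof -
    have a0': "a0 \<in> {0<..1}" using a0 by simp
    have "q\<^sup>2 = 3 * (1 / l1\<^sup>2 + 1)" unfolding q_def by (rule real_sqrt_pow2) simp
    then have "c a0 \<le> (q * a0)\<^sup>2" using c(3)[OF a0'] D(3)[OF a0'] by (simp add: power_mult_distrib algebra_simps)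
    then have "sqrt (energy (k2 a0)) \<le> q * a0" using k2[OF a0'] real_sqrt_le_mono[of "c a0" "(q * a0)\<^sup>2"] q a0 by simp
    also have "q * a0 = exp (- l2)" using q by (simp add: a0_def)
    finally have "l2 \<le> time (k2 a0) (pi / 2)" using exp_time_le[of "k2 a0"] k2[OF a0'] by (metis exp_le_cancel_iff neg_le_iff_le order_trans)
    also have "\<dots> \<le> S a0" unfolding S_def
      using k2[OF a0'] arcsin_height(2)[of a0 "k2 a0"] a0 by (subst time_le_iff) auto
    finally show ?thesis .
  qed
  have "continuous_on {a0..1} S" using a0 by (intro continuous_on_subset[OF cS]) auto
  then obtain a where "a0 \<le> a" "a \<le> 1" and Sa: "S a = l2" using IVT2'[of S 1 l2 a0] S0 S1 a0 by blast
  then have a: "a \<in> {0<..1}" using a0 by simp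
  have k2a: "k2 a > 1" "energy (k2 a) = c a" using k2[OF a] by auto
  note h = arcsin_height[of a "k2 a"]
  \<comment> \<open>The final angle lies beyond \<open>pi / 2\<close>, on the descending branch;
    this selects the root once the square of the slope is known.\<close>
  have "wave_deriv (k2 a) l2 < 0"
    unfolding Sa[symmetric] S_def wave_deriv_def ang_time[OF k2a(1)]
    using h a k2a speed_pos[OF k2a(1)] amp_gt_1[OF k2a(1)] cos_gt_zero[of "arcsin (a / amp (k2 a))"]
    by (simp add: mult_less_0_iff cos_diff)
  moreover have "(wave_deriv (k2 a) l2)\<^sup>2 = (D a + \<sigma> * r a)\<^sup>2"
  proof -
    have "wave (k2 a) l2 = a" using wave_time[OF k2a(1)] h(3) a k2a unfolding Sa[symmetric] S_def by simp
    then have "(wave_deriv (k2 a) l2)\<^sup>2 = c a + potential a"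
      using wave_deriv_sq[OF k2a(1), of l2] k2a by (simp add: potential_def)
    moreover have "(r a)\<^sup>2 = potential a" using potential_bounds[of a] a by (simp add: r_def)
    ultimately show ?thesis using \<sigma> unfolding c_def by (auto simp: power2_eq_square algebra_simps)
  qed
  ultimately have "wave_deriv (k2 a) l2 = - (D a + \<sigma> * r a)" using c(4)[OF a] by (auto simp: power2_eq_iff)
  then show ?thesis using a k1[OF a] k2a Sa D(4)[OF a]
    by (intro exI[of _ a] exI[of _ "k1 a"] exI[of _ "k2 a"]) (auto simp: S_def rise_def r_def)
qed

subsection \<open>Solitons\<close>

text \<open>The positive even homoclinic solution on the line, a power of the hyperbolic
  secant.\<close>

definition soliton :: "real \<Rightarrow> real" where
  "soliton x = (p / 2) powr (1 / (p - 2)) * cosh ((p - 2) / 2 * x) powr (- 2 / (p - 2))"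

definition soliton_deriv :: "real \<Rightarrow> real" where
  "soliton_deriv x = - soliton x * tanh ((p - 2) / 2 * x)"

lemma soliton_pos: "soliton x > 0"
  using p_gt_2 by (simp add: soliton_def)

lemma has_real_derivative_soliton:
  "(soliton has_real_derivative soliton_deriv x) (at x)"
proof -
  define \<beta> where "\<beta> = (p - 2) / 2"
  have b: "\<beta> > 0" "- 2 / (p - 2) = - 1 / \<beta>" using p_gt_2 by (auto simp: \<beta>_def field_simps)
  have c: "((\<lambda>x. cosh (\<beta> * x)) has_real_derivative sinh (\<beta> * x) * \<beta>) (at x)"
    by (auto intro!: derivative_eq_intros)
  have "((\<lambda>x. cosh (\<beta> * x) powr (- 1 / \<beta>)) has_real_derivative
    (- 1 / \<beta> * cosh (\<beta> * x) powr (- 1 / \<beta> - 1)) * (sinh (\<beta> * x) * \<beta>)) (at x)"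
    by (rule DERIV_chain2[where f = "\<lambda>y. y powr (- 1 / \<beta>)", OF has_real_derivative_powr c]) simp
  from DERIV_cmult[OF this, of "(p / 2) powr (1 / (p - 2))"] show ?thesis
    unfolding soliton_def[abs_def] soliton_deriv_def soliton_def b(2) \<beta>_def[symmetric]
    by (rule DERIV_cong) (use b(1) in \<open>simp add: powr_diff tanh_def\<close>)
qed

text \<open>In terms of \<open>tanh\<close>, verifying the equation and the zero energy reduces to
  polynomial identities.\<close>

lemma soliton_powr: "soliton x powr (p - 2) = p / 2 * (1 - (tanh ((p - 2) / 2 * x))\<^sup>2)"
proof -
  have e: "1 / (p - 2) * (p - 2) = 1" "- 2 / (p - 2) * (p - 2) = - 2" using p_gt_2 by (auto intro!: iffD1[OF nonzero_eq_divide_eq refl] simp del: times_divide_eq_left)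
  have "soliton x powr (p - 2) = p / 2 * cosh ((p - 2) / 2 * x) powr (- 2)"
    unfolding soliton_def powr_mult powr_powr e using p_gt_2 by simp
  also have "cosh ((p - 2) / 2 * x) powr (- 2) = 1 / (cosh ((p - 2) / 2 * x))\<^sup>2"
    by (rule powr_neg_numeral) simp
  also have "\<dots> = 1 - (tanh ((p - 2) / 2 * x))\<^sup>2"
    unfolding hyperbolic_pythagoras[of "(p - 2) / 2 * x", symmetric]
      diff_divide_distrib[of "(cosh ((p - 2) / 2 * x))\<^sup>2"] tanh_def power_divide
    by (simp add: hyperbolic_pythagoras)
  finally show ?thesis .
qed

lemma has_real_derivative_soliton_deriv:
  "(soliton_deriv has_real_derivative soliton x - \<bar>soliton x\<bar> powr (p - 2) * soliton x) (at x)"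
proof -
  define \<beta> where "\<beta> = (p - 2) / 2"
  have "((\<lambda>x. tanh (\<beta> * x)) has_real_derivative (1 - (tanh (\<beta> * x))\<^sup>2) * \<beta>) (at x)"
    by (auto intro!: derivative_eq_intros)
  from DERIV_mult[OF DERIV_minus[OF has_real_derivative_soliton] this]
  have "((\<lambda>x. - soliton x * tanh (\<beta> * x)) has_real_derivative
    - soliton_deriv x * tanh (\<beta> * x) + (1 - (tanh (\<beta> * x))\<^sup>2) * \<beta> * - soliton x) (at x)" .
  moreover have k: "\<bar>soliton x\<bar> powr (p - 2) = (1 + \<beta>) * (1 - (tanh (\<beta> * x))\<^sup>2)"
    using soliton_powr[of x] soliton_pos[of x] by (simp add: \<beta>_def add_divide_distrib diff_divide_distrib)
  ultimately show ?thesis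
    unfolding soliton_deriv_def[abs_def] \<beta>_def[symmetric]
    by (elim DERIV_cong) (unfold k, simp add: power2_eq_square algebra_simps)
qed

lemma soliton_deriv_sq: "(soliton_deriv x)\<^sup>2 = potential (soliton x)"
proof -
  have "soliton x powr p = soliton x powr (p - 2) * (soliton x)\<^sup>2"
    using soliton_pos[of x] powr_add[of "soliton x" "p - 2" 2] by (simp add: powr_numeral)
  then have "2 / p * soliton x powr p = (1 - (tanh ((p - 2) / 2 * x))\<^sup>2) * (soliton x)\<^sup>2"
    using p_gt_2 by (simp add: soliton_powr field_simps)
  then show ?thesis using soliton_pos[of x]
    by (simp add: potential_def soliton_deriv_def power_mult_distrib left_diff_distrib)
qed

text \<open>The bound \<open>cosh y \<ge> exp y / 2\<close> is raised to a negative power. It holds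
  on the whole line, so a shift only changes the constant.\<close>

lemma soliton_exp_bound: "\<exists>C>0. \<forall>x. soliton x \<le> C * exp (- x)"
proof (intro exI conjI allI)
  let ?b = "2 / (p - 2)"
  fix x
  have e: "(p - 2) / 2 * x * - ?b = - x" using p_gt_2 by simp
  have "exp ((p - 2) / 2 * x) / 2 \<le> cosh ((p - 2) / 2 * x)" by (simp add: cosh_def)
  then have "cosh ((p - 2) / 2 * x) powr (- ?b) \<le> (exp ((p - 2) / 2 * x) / 2) powr (- ?b)"
    using p_gt_2 by (intro powr_mono2') auto
  also have "(exp ((p - 2) / 2 * x) / 2) powr (- ?b) = 2 powr ?b * exp (- x)"
    unfolding powr_divide exp_powr_real e by (simp add: powr_minus field_simps)
  finally show "soliton x \<le> (p / 2) powr (1 / (p - 2)) * 2 powr ?b * exp (- x)"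
    using p_gt_2 by (simp add: soliton_def mult.assoc)
qed (use p_gt_2 in simp)

lemma soliton_less: "x \<noteq> 0 \<Longrightarrow> soliton x < soliton 0"
proof -
  assume "x \<noteq> 0"
  then have "1 < cosh ((p - 2) / 2 * x)"
    using p_gt_2 cosh_real_ge_1[of "(p - 2) / 2 * x"] cosh_real_one_iff[of "(p - 2) / 2 * x"]
    by (simp only: less_le) simp
  then have "cosh ((p - 2) / 2 * x) powr (- 2 / (p - 2)) < 1 powr (- 2 / (p - 2))"
    using p_gt_2 by (intro powr_less_mono2_neg) auto
  then show ?thesis using p_gt_2 by (simp add: soliton_def)
qed

lemma soliton_surj:
  assumes "0 < a" "a \<le> 1"
  shows "\<exists>s>0. soliton s = a"
proof -
  obtain C where C: "C > 0" "\<And>x. soliton x \<le> C * exp (- x)" using soliton_exp_bound by blast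
  define N where "N = max 0 (- ln (a / C))"
  have "soliton N \<le> C * exp (- N)" by (rule C)
  also have "\<dots> \<le> C * exp (ln (a / C))" using C(1) by (intro mult_left_mono) (auto simp: N_def)
  also have "\<dots> = a" using C assms by simp
  finally have N: "soliton N \<le> a" .
  have "1 < soliton 0" using p_gt_2 powr_less_mono2[of "1 / (p - 2)" 1 "p / 2"] by (simp add: soliton_def)
  then have 0: "a < soliton 0" using assms by simp
  have "continuous_on {0..N} soliton"
    by (rule DERIV_continuous_on[OF has_field_derivative_at_within[OF has_real_derivative_soliton]])
  then obtain s where "0 \<le> s" "soliton s = a" using IVT2'[of soliton N a 0] N 0 unfolding N_def
    by (metis max.cobounded1 less_imp_le)
  then show ?thesis using 0 by (intro exI[of _ s]) (auto simp: less_le)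
qed

lemma soliton_slope:
  assumes "s > 0" "\<sigma> = 1 \<or> \<sigma> = - 1"
  shows "soliton (\<sigma> * s) = soliton s" "soliton_deriv (\<sigma> * s) = - \<sigma> * sqrt (potential (soliton s))"
proof -
  show eq: "soliton (\<sigma> * s) = soliton s" using assms by (auto simp: soliton_def)
  have "tanh ((p - 2) / 2 * s) > 0" using assms p_gt_2 by simp
  then have "soliton_deriv s < 0" using soliton_pos[of s] by (simp add: soliton_deriv_def)
  then have "sqrt (potential (soliton s)) = - soliton_deriv s" unfolding soliton_deriv_sq[symmetric] by simp
  then show "soliton_deriv (\<sigma> * s) = - \<sigma> * sqrt (potential (soliton s))"
    using assms eq by (auto simp: soliton_deriv_def)
qed

subsection \<open>Solutions on the graph\<close>

lemma H1_on_edge: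
  assumes "\<And>x. (f has_real_derivative f' x) (at x)" "\<And>x. (f' has_real_derivative f'' x) (at x)"
    and "L2_on I f" "L2_on I f'"
  shows "H1_on I f"
  unfolding H1_on_def using assms weak_derivative_on_C1[of f f' I] DERIV_isCont
  by (metis continuous_at_imp_continuous_on)

text \<open>The bounded edges carry waves run backwards, \<open>wave \<kappa> (l - x)\<close>, so
  that the zero at the start of the wave sits at the outer vertex. All three pieces are twice
  differentiable on the whole line, which settles regularity at the endpoints.\<close>

lemma kirchhoff_solution_exists:
  assumes l1: "0 < l1" "l1 \<le> 1 / 4" and k: "k > 1" "energy k \<le> 8" "pi / sqrt (k - 1) < l2"
    and \<sigma>: "\<sigma> = 1 \<or> \<sigma> = - 1"
  shows "\<exists>u s. s > 0 \<and> kirchhoff_solution p l1 l2 u \<and> nonneg_on_graph l1 l2 u \<and>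
    (\<forall>x. u Half_Line x = soliton (x + \<sigma> * s))"
proof -
  obtain a \<kappa>1 \<kappa>2 where a: "0 < a" "a \<le> 1" and \<kappa>: "1 < \<kappa>1" "1 < \<kappa>2"
    and t: "l1 = time \<kappa>1 (arcsin (a / amp \<kappa>1))" "l2 = time \<kappa>2 (pi - arcsin (a / amp \<kappa>2))"
    and bal: "\<sigma> * sqrt (potential a) + wave_deriv \<kappa>1 l1 + wave_deriv \<kappa>2 l2 = 0"
    using edge_balance[OF assms] by blast
  obtain s where s: "s > 0" "soliton s = a" using soliton_surj[OF a] by blast
  have l2: "l2 > 0" using k by (intro less_trans[OF _ k(3)]) simp
  note h1 = arcsin_height[OF a \<kappa>(1)] and h2 = arcsin_height[OF a \<kappa>(2)]
  define u where "u = (\<lambda>e x. case e of Half_Line \<Rightarrow> soliton (x + \<sigma> * s)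
    | Edge1 \<Rightarrow> wave \<kappa>1 (l1 - x) | Edge2 \<Rightarrow> wave \<kappa>2 (l2 - x))"
  define u' where "u' = (\<lambda>e x. case e of Half_Line \<Rightarrow> soliton_deriv (x + \<sigma> * s)
    | Edge1 \<Rightarrow> - wave_deriv \<kappa>1 (l1 - x) | Edge2 \<Rightarrow> - wave_deriv \<kappa>2 (l2 - x))"
  have sh: "((\<lambda>x. x + \<sigma> * s) has_real_derivative 1) (at x)" "((\<lambda>x. l - x) has_real_derivative - 1) (at x)" for x l
    using DERIV_add[OF DERIV_ident DERIV_const] DERIV_diff[OF DERIV_const DERIV_ident] by fastforce+
  have d1: "(u e has_real_derivative u' e x) (at x)" for e x
    using DERIV_chain2[OF has_real_derivative_soliton sh(1)[of x]]
      DERIV_chain2[OF has_real_derivative_wave[OF \<kappa>(1)] sh(2)[of l1 x]]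
      DERIV_chain2[OF has_real_derivative_wave[OF \<kappa>(2)] sh(2)[of l2 x]]
    by (cases e) (simp_all add: u_def u'_def)
  have d2: "(u' e has_real_derivative u e x - \<bar>u e x\<bar> powr (p - 2) * u e x) (at x)" for e x
    using DERIV_chain2[OF has_real_derivative_soliton_deriv sh(1)[of x]]
      DERIV_minus[OF DERIV_chain2[OF has_real_derivative_wave_deriv[OF \<kappa>(1)] sh(2)[of l1 x]]]
      DERIV_minus[OF DERIV_chain2[OF has_real_derivative_wave_deriv[OF \<kappa>(2)] sh(2)[of l2 x]]]
    by (cases e) (simp_all add: u_def u'_def)
  have cont: "continuous_on UNIV (u e)" "continuous_on UNIV (u' e)" for e
    using DERIV_isCont[OF d1] DERIV_isCont[OF d2] by (auto simp: continuous_on_eq_continuous_at)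
  have u0: "u e 0 = a" for e
    using soliton_slope(1)[OF s(1) \<sigma>] s(2) wave_time[OF \<kappa>(1)] wave_time[OF \<kappa>(2)] h1(3) h2(3) t
    by (cases e) (simp_all add: u_def)
  have ode: "ode_on p (interior (edge_dom l1 l2 e)) (u e)" for e
    unfolding ode_on_def using d1 d2
    by (intro exI[of _ "u' e"] exI[of _ "\<lambda>x. u e x - \<bar>u e x\<bar> powr (p - 2) * u e x"]) auto
  have "H1_on (interior (edge_dom l1 l2 e)) (u e)" for e
  proof (rule H1_on_edge[OF d1 d2])
    obtain C where C: "C > 0" "\<And>x. soliton x \<le> C * exp (- x)" using soliton_exp_bound by blast
    have b: "\<bar>u Half_Line x\<bar> \<le> C * exp (- \<sigma> * s) * exp (- x)" for x
      using C(2)[of "x + \<sigma> * s"] soliton_pos[of "x + \<sigma> * s"] by (simp add: u_def exp_diff exp_minus field_simps)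
    have b': "\<bar>u' Half_Line x\<bar> \<le> C * exp (- \<sigma> * s) * exp (- x)" for x
    proof -
      have "\<bar>u' Half_Line x\<bar> \<le> \<bar>u Half_Line x\<bar> * 1"
        unfolding u'_def u_def soliton_deriv_def edge.case abs_mult abs_minus_cancel
        by (intro mult_left_mono abs_leI) (use tanh_real_bounds[of "(p - 2) / 2 * (x + \<sigma> * s)"] in auto)
      then show ?thesis using b[of x] by simp
    qed
    show "L2_on (interior (edge_dom l1 l2 e)) (u e)" "L2_on (interior (edge_dom l1 l2 e)) (u' e)"
      using L2_on_bounded_interval[OF cont(1)] L2_on_bounded_interval[OF cont(2)]
        L2_on_exp_decay[OF cont(1) b] L2_on_exp_decay[OF cont(2) b']
      by (cases e; simp)+
  qed
  then have "u \<in> H10_graph l1 l2"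
    unfolding H10_graph_def continuous_on_graph_def using cont u0 \<kappa>
    by (auto intro: continuous_on_subset simp: u_def)
  \<comment> \<open>Reversing the bounded edges flips their slopes, and the soliton has slope
    \<open>- \<sigma> * sqrt (potential a)\<close>; the sum of derivatives is the negative of the
    left side of \<open>bal\<close>.\<close>
  moreover have "kirchhoff l1 l2 u"
    unfolding kirchhoff_def using bal d1 soliton_slope(2)[OF s(1) \<sigma>] s(2)
    by (intro exI[of _ "\<lambda>e. u' e 0"]) (auto simp: u'_def intro: has_field_derivative_at_within)
  ultimately have "kirchhoff_solution p l1 l2 u" using ode by (simp add: kirchhoff_solution_def)
  moreover have "nonneg_on_graph l1 l2 u"
    unfolding nonneg_on_graph_def
  proof (intro allI ballI)
    fix e x assume "x \<in> edge_dom l1 l2 e"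
    then show "0 \<le> u e x"
      using soliton_pos[of "x + \<sigma> * s"] h1 h2 \<kappa> t
        wave_nonneg[OF \<kappa>(1), of "arcsin (a / amp \<kappa>1)" "l1 - x"]
        wave_nonneg[OF \<kappa>(2), of "pi - arcsin (a / amp \<kappa>2)" "l2 - x"]
      by (cases e) (auto simp: u_def)
  qed
  ultimately show ?thesis using s(1) by (intro exI[of _ u] exI[of _ s]) (simp add: u_def)
qed

end

theorem proposition13:
  fixes p :: real
  assumes "p > 2"
  shows "\<exists>\<delta>>0. \<exists>L>0. \<forall>l1 l2. 0 < l1 \<and> l1 < \<delta> \<and> L < l2 \<longrightarrow>
           (\<exists>u v. kirchhoff_solution p l1 l2 u \<and> nonneg_on_graph l1 l2 u \<and>
                  \<not> eq_on_graph l1 l2 u (\<lambda>_ _. 0) \<and>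
                  kirchhoff_solution p l1 l2 v \<and> nonneg_on_graph l1 l2 v \<and>
                  \<not> eq_on_graph l1 l2 v (\<lambda>_ _. 0) \<and>
                  \<not> eq_on_graph l1 l2 u v)"
proof -
  interpret nls_power p by unfold_locales (rule assms)
  \<comment> \<open>This \<open>k\<close> depends on \<open>p\<close> alone, and so does the
    threshold \<open>pi / sqrt (k - 1)\<close> for \<open>l2\<close>.\<close>
  obtain k where k: "k > 1" "energy k \<le> 8" using energy_small[of 8] by auto
  have "\<exists>u v. kirchhoff_solution p l1 l2 u \<and> nonneg_on_graph l1 l2 u \<and>
      \<not> eq_on_graph l1 l2 u (\<lambda>_ _. 0) \<and>
      kirchhoff_solution p l1 l2 v \<and> nonneg_on_graph l1 l2 v \<and>
      \<not> eq_on_graph l1 l2 v (\<lambda>_ _. 0) \<and>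
      \<not> eq_on_graph l1 l2 u v"
    if l: "0 < l1 \<and> l1 < 1 / 4 \<and> pi / sqrt (k - 1) < l2" for l1 l2
  proof -
    obtain u s where u: "s > 0" "kirchhoff_solution p l1 l2 u" "nonneg_on_graph l1 l2 u"
      "\<And>x. u Half_Line x = soliton (x + s)"
      using kirchhoff_solution_exists[of l1 k l2 1] l k by auto
    obtain v t where v: "t > 0" "kirchhoff_solution p l1 l2 v" "nonneg_on_graph l1 l2 v"
      "\<And>x. v Half_Line x = soliton (x - t)"
      using kirchhoff_solution_exists[of l1 k l2 "- 1"] l k by auto
    have nz: "\<not> eq_on_graph l1 l2 u w" if "0 \<le> x" "u Half_Line x \<noteq> w Half_Line x" for u w x
      using that unfolding eq_on_graph_def by (metis atLeast_iff edge_dom.simps(1))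
    \<comment> \<open>At \<open>t\<close> the second solution attains the peak
      \<open>soliton 0\<close>, whereas the first is already past its peak, at
      \<open>soliton (t + s)\<close>.\<close>
    have "u Half_Line t \<noteq> v Half_Line t" using soliton_less[of "t + s"] u v by simp
    then have "\<not> eq_on_graph l1 l2 u v" using v(1) by (intro nz[of t]) auto
    moreover have "\<not> eq_on_graph l1 l2 u (\<lambda>_ _. 0)" "\<not> eq_on_graph l1 l2 v (\<lambda>_ _. 0)"
      using soliton_pos[of s] soliton_pos[of "- t"] by (intro nz[of 0]; simp add: u v)+
    ultimately show ?thesis using u v by blast
  qed
  then show ?thesis using k by (intro exI[of _ "1 / 4"] exI[of _ "pi / sqrt (k - 1)"] conjI) auto
qed

end
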